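(* Let $(u_n(t))_{n=0}^\infty$ be solutions to the mixed-value problem $$ \frac{d^2u_n}{dt^2}-\left(c^2+\beta\frac{d}{dt}\right)\Delta_x^2u_n+\gamma\frac{du_n}{dt}+m^2u_n+V'(u_n)=0,\qquad n\in\mathbb{Z}^+, $$ subject to $u_n(0)=\phi(n)$ and $\frac{du_n}{dt}(0)=\varphi(n)$ for $n\in\mathbb{Z}^+$, and $u_0(t)=\psi(t)$ for $t\ge 0$, such that $(\dot u_n(t))_{n=0}^\infty$ is square-summable at any fixed time $t$. Then the instantaneous rate of change of the total energy $E$ in the system is given by $$ \frac{dE}{dt}=c^2(u_0-u_1)\dot u_0-\gamma\sum_{n=1}^\infty(\dot u_n)^2-\beta\left[\sum_{n=1}^\infty(\dot u_n-\dot u_{n-1})^2+(\dot u_1-\dot u_0)\dot u_0\right]. $$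
   Context: Here $\beta,\gamma\ge 0$ are constants (internal and external damping), $m^2$ is a real constant ($m$ may be real or pure-imaginary), $c$ is the coupling coefficient ($c\gg 1$), $\Delta_x^2u_n=u_{n+1}-2u_n+u_{n-1}$ for $n\in\mathbb{Z}^+=\{1,2,\dots\}$, a dot denotes $d/dt$, and the boundary function $\psi$ is continuously differentiable on $(0,+\infty)$. The functions $\phi,\varphi:\mathbb{Z}^+\to\mathbb{R}$ are the initial data. The potential $V$ is $V(u)=1-\cos u$ (sine-Gordon chain), or $V(u)=\frac{1}{2!}u^2-\frac{1}{4!}u^4+\frac{1}{6!}u^6$ with zero mass $m=0$ (Klein-Gordon chain). A real sequence $(a_n)_{n=0}^\infty$ is square-summable if $\sum a_n^2$ converges. The energy density of the $n$-th oscillator is $H_n=\frac12\left[\dot u_n^2+c^2(u_{n+1}-u_n)^2+m^2u_n^2\right]+V(u_n)$, and the total energy of the system at time $t$ is $$ E=\sum_{n=1}^\infty H_n+\frac{c^2}{2}(u_1-u_0)^2 . $$ *)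

theory Defs
  imports "HOL-Analysis.Analysis"
begin

definition laplacian :: "(nat \<Rightarrow> real) \<Rightarrow> nat \<Rightarrow> real" where
  "laplacian a n = a (n + 1) - 2 * a n + a (n - 1)"

definition sine_gordon_potential :: "real \<Rightarrow> real" where
  "sine_gordon_potential x = 1 - cos x"

definition klein_gordon_potential :: "real \<Rightarrow> real" where
  "klein_gordon_potential x = x^2 / fact 2 - x^4 / fact 4 + x^6 / fact 6"

definition square_summable :: "(nat \<Rightarrow> real) \<Rightarrow> bool" where
  "square_summable a \<longleftrightarrow> summable (\<lambda>n. (a n)^2)"

text \<open>Throughout, \<open>u n t\<close> is the position of the \<open>n\<close>-th oscillator at time \<open>t\<close>, and \<open>m2\<close> is the
  real number \<open>m\<^sup>2\<close>, which is negative when the mass \<open>m\<close> is imaginary.\<close>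

text \<open>The boundary function need not be differentiable at time \<open>0\<close>, so the equations of motion
  are imposed for \<open>t > 0\<close>; the initial velocities are one-sided derivatives.\<close>

definition mixed_value_solution ::
  "real \<Rightarrow> real \<Rightarrow> real \<Rightarrow> real \<Rightarrow> (real \<Rightarrow> real) \<Rightarrow> (nat \<Rightarrow> real) \<Rightarrow> (nat \<Rightarrow> real) \<Rightarrow> (real \<Rightarrow> real)
    \<Rightarrow> (nat \<Rightarrow> real \<Rightarrow> real) \<Rightarrow> bool" where
  "mixed_value_solution c \<beta> \<gamma> m2 V \<phi> \<phi>v \<psi> u \<longleftrightarrow>
    (\<forall>n\<ge>1. \<forall>t>0.
       u n differentiable (at t) \<and> deriv (u n) differentiable (at t) \<and>
       deriv (deriv (u n)) t
         - (c^2 * laplacian (\<lambda>k. u k t) n + \<beta> * deriv (\<lambda>s. laplacian (\<lambda>k. u k s) n) t)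
         + \<gamma> * deriv (u n) t + m2 * u n t + deriv V (u n t) = 0) \<and>
    (\<forall>n\<ge>1. u n 0 = \<phi> n \<and> (u n has_real_derivative \<phi>v n) (at 0 within {0..})) \<and>
    (\<forall>t\<ge>0. u 0 t = \<psi> t)"

definition energy_density ::
  "real \<Rightarrow> real \<Rightarrow> (real \<Rightarrow> real) \<Rightarrow> (nat \<Rightarrow> real \<Rightarrow> real) \<Rightarrow> nat \<Rightarrow> real \<Rightarrow> real" where
  "energy_density c m2 V u n t =
    1 / 2 * ((deriv (u n) t)^2 + c^2 * (u (n + 1) t - u n t)^2 + m2 * (u n t)^2) + V (u n t)"

definition total_energy ::
  "real \<Rightarrow> real \<Rightarrow> (real \<Rightarrow> real) \<Rightarrow> (nat \<Rightarrow> real \<Rightarrow> real) \<Rightarrow> real \<Rightarrow> real" where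
  "total_energy c m2 V u t =
    (\<Sum>n. energy_density c m2 V u (Suc n) t) + c^2 / 2 * (u 1 t - u 0 t)^2"

end

theory Submission
  imports Defs
begin

text \<open>
  Write \<open>v n = deriv (u n)\<close> and let \<open>f n\<close> be the sum of the elastic and potential forces on the
  \<open>n\<close>-th oscillator, so that \<open>v' = f + \<beta> \<Delta>v - \<gamma> v\<close>. Differentiating the energy density at each
  site and summing by parts gives the asserted rate, apart from two points: the series of energy
  densities has to be differentiated, although its summability and that of \<open>v\<^sup>2\<close> are only known
  separately at each time, and the flux of energy through the far end of the chain has to vanish.

  Locally uniform bounds. The times near which the \<open>l\<^sup>2\<close> norm of \<open>v\<close> is bounded form an open set. If
  its complement were nonempty, Baire's theorem would give a piece of it on which the norm is
  bounded by some \<open>M\<close>, and the gaps of that piece are intervals with end points in the piece.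
  The equations of motion carry the bound from the end points into the gap, with a constant that
  is independent of the gap, so the piece would consist of good times (\<open>bounded_by_propagation\<close>).
  For a globally Lipschitz force, \<open>v t = v s + (t - s) f s + O(|t - s| sup |v|)\<close> in \<open>l\<^sup>2\<close>, which on a
  short gap bounds first \<open>(b - a) f a\<close> and then \<open>v\<close> by the values of \<open>v\<close> at the two ends; thus no
  a priori bound on the forces is needed, which is what an imaginary mass calls for
  (\<open>bounded_if_Lipschitz\<close>). For the Klein-Gordon potential the energy is coercive, and its rate
  is bounded by a multiple of the energy plus one (\<open>bounded_if_coercive\<close>).

  Differentiation. Once \<open>v\<close> is bounded in \<open>l\<^sup>2\<close> on a compact interval, the same secant estimate
  shows that the forces are square-summable, and both \<open>u\<close> (up to its initial value) and \<open>v\<close> at the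
  inner sites are differentiable as curves in \<open>l\<^sup>2\<close>. The increment of the energy between two times
  \<open>s\<close> and \<open>t\<close> is \<open>(|v t|\<^sup>2 - |v s|\<^sup>2) / 2 - \<langle>f s, u t - u s\<rangle>\<close> plus boundary terms at the driven end, a
  remainder quadratic in \<open>u t - u s\<close>, and the limit of the flux (\<open>energy_increment\<close>), and each of
  these is differentiated in turn (\<open>energy_derivative\<close>).

  The flux. The terms \<open>(u (N + 1) s - u N s) * (u (N + 1) t - u (N + 1) s)\<close> converge because
  everything else in the energy balance does, and the second factor tends to zero. So the limit is
  zero unless \<open>|u (N + 1) s - u N s|\<close> tends to infinity. For \<open>m\<^sup>2 \<ge> 0\<close> this cannot
  happen, because the energy densities are sums of nonnegative terms and tend to zero. For \<open>m\<^sup>2 < 0\<close> the potential is that of sine-Gordon, and an escaping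
  chain whose energy densities and forces both tend to zero would need \<open>- m\<^sup>2 / c\<^sup>2 \<in> {2, 4}\<close> and
  values approaching \<open>\<pi> \<int>\<close> along a sign-alternating pattern, which keeps them bounded
  (\<open>sine_gordon_increments_not_at_top\<close>).
\<close>

section \<open>Bounds that propagate from a Baire set\<close>

text \<open>Baire's theorem applied to the closed sublevel sets of \<open>sup g\<close>: countably many of them cover \<open>P\<close>,
  so one contains a relatively open piece of \<open>P\<close>.\<close>

lemma baire_uniform_bound_somewhere:
  fixes g :: "nat \<Rightarrow> real \<Rightarrow> real"
  assumes "closed P" "P \<noteq> {}"
    and cont: "\<And>N. continuous_on P (g N)"
    and fin: "\<And>t. t \<in> P \<Longrightarrow> \<exists>k. \<forall>N. g N t \<le> k"
  obtains p \<epsilon> k where "p \<in> P" "\<epsilon> > 0" "\<And>t N. t \<in> P \<Longrightarrow> \<bar>t - p\<bar> < \<epsilon> \<Longrightarrow> g N t \<le> k"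
proof -
  define U where "U k = P - (\<Inter>N. {t\<in>P. g N t \<le> real k})" for k :: nat
  have open_U: "openin (top_of_set P) (U k)" for k
  proof -
    have "closed {t \<in> P. g N t \<le> real k}" for N
      using continuous_closed_preimage[OF cont \<open>closed P\<close>, of "{..real k}" N]
      by (simp add: vimage_def Int_def conj_commute)
    then have "closedin (top_of_set P) (\<Inter>N. {t\<in>P. g N t \<le> real k})"
      by (intro closed_subset closed_INT) auto
    then show ?thesis
      unfolding U_def by (intro openin_diff) auto
  qed
  have "(\<Inter>k. U k) = {}"
  proof (rule ccontr)
    assume "(\<Inter>k. U k) \<noteq> {}"
    then obtain t where t: "\<And>k. t \<in> U k" by auto
    then have "t \<in> P" by (auto simp: U_def)
    from fin[OF this] obtain k where k: "\<And>N. g N t \<le> k" by auto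
    obtain n where "k \<le> real n" using real_arch_simple by blast
    then have "t \<notin> U n" using k \<open>t \<in> P\<close> by (auto simp: U_def intro: order_trans)
    with t show False by blast
  qed
  then have "\<not> P \<subseteq> closure (\<Inter>(range U))"
    using \<open>P \<noteq> {}\<close> by auto
  then obtain k where "\<not> P \<subseteq> closure (U k)"
    using Baire[OF \<open>closed P\<close>, of "range U"] open_U by blast
  then obtain p where p: "p \<in> P" "p \<notin> closure (U k)" by blast
  then obtain \<epsilon> where \<epsilon>: "\<epsilon> > 0" "\<And>t. t \<in> U k \<Longrightarrow> \<not> dist t p < \<epsilon>"
    unfolding closure_approachable by blast
  show thesis
  proof (rule that[OF p(1) \<epsilon>(1), of "real k"])
    fix t N assume "t \<in> P" "\<bar>t - p\<bar> < \<epsilon>"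
    then show "g N t \<le> real k"
      using \<epsilon>(2)[of t] by (auto simp: U_def dist_real_def)
  qed
qed

text \<open>A family of continuous functions that is bounded at each time is bounded uniformly on \<open>{\<alpha>..\<beta>}\<close>
  as soon as bounds propagate along short intervals. The two hypotheses play different roles.
  By \<open>interior\<close>, boundedness on the compact subintervals of a gap, with no control of the bound,
  becomes boundedness up to the ends of the gap; \<open>ends\<close> then replaces this bound by one that
  depends only on the values at the two ends, hence not on the gap.\<close>

lemma bounded_by_propagation:
  fixes g :: "nat \<Rightarrow> real \<Rightarrow> real"
  assumes "0 < h"
    and cont: "\<And>N. continuous_on {\<alpha>..\<beta>} (g N)"
    and fin: "\<And>t. t \<in> {\<alpha>..\<beta>} \<Longrightarrow> \<exists>k. \<forall>N. g N t \<le> k"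
    and interior: "\<And>s. s \<in> {\<alpha>..\<beta>} \<Longrightarrow> \<exists>C. \<forall>a b k.
        \<alpha> \<le> a \<and> a < b \<and> b \<le> \<beta> \<and> b - a < h \<and> s \<in> {a..b} \<and> (\<forall>t\<in>{a..b}. \<forall>N. g N t \<le> k)
        \<longrightarrow> (\<forall>t\<in>{a..b}. \<forall>N. g N t \<le> C)"
    and ends: "\<And>K. \<exists>C. \<forall>a b k.
        \<alpha> \<le> a \<and> a < b \<and> b \<le> \<beta> \<and> b - a < h \<and> (\<forall>N. g N a \<le> K) \<and> (\<forall>N. g N b \<le> K)
        \<and> (\<forall>t\<in>{a..b}. \<forall>N. g N t \<le> k) \<longrightarrow> (\<forall>t\<in>{a..b}. \<forall>N. g N t \<le> C)"
  shows "\<exists>k. \<forall>t\<in>{\<alpha>..\<beta>}. \<forall>N. g N t \<le> k"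
proof -
  define good where
    "good t \<longleftrightarrow> (\<exists>\<epsilon>>0. \<exists>k. \<forall>r\<in>{\<alpha>..\<beta>}. \<bar>r - t\<bar> < \<epsilon> \<longrightarrow> (\<forall>N. g N r \<le> k))" for t
  have compact_bound: "\<exists>k. \<forall>t\<in>{a..b} \<inter> {\<alpha>..\<beta>}. \<forall>N. g N t \<le> k"
    if "a \<le> b" and all_good: "\<And>t. t \<in> {a..b} \<Longrightarrow> good t" for a b
    using \<open>a \<le> b\<close>
  proof (induction rule: Bolzano)
    case (trans x y z)
    then obtain k l where "\<forall>t\<in>{x..y} \<inter> {\<alpha>..\<beta>}. \<forall>N. g N t \<le> k"
      "\<forall>t\<in>{y..z} \<inter> {\<alpha>..\<beta>}. \<forall>N. g N t \<le> l" by blast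
    then have "\<forall>t\<in>{x..z} \<inter> {\<alpha>..\<beta>}. \<forall>N. g N t \<le> max k l"
      by (metis Int_iff atLeastAtMost_iff le_max_iff_disj linorder_le_cases)
    then show ?case by blast
  next
    case (local x)
    then obtain \<epsilon> k where \<epsilon>: "\<epsilon> > 0"
      "\<forall>r\<in>{\<alpha>..\<beta>}. \<bar>r - x\<bar> < \<epsilon> \<longrightarrow> (\<forall>N. g N r \<le> k)"
      using all_good[of x] unfolding good_def by auto
    have "\<forall>t\<in>{c..d} \<inter> {\<alpha>..\<beta>}. \<forall>N. g N t \<le> k" if "c \<le> x \<and> x \<le> d \<and> d - c < \<epsilon>" for c d
      using \<epsilon>(2) that by auto
    then show ?case using \<epsilon>(1) by blast
  qed
  \<comment> \<open>the exceptional times, which are to be shown not to exist\<close>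
  define P where "P = {t \<in> {\<alpha>..\<beta>}. \<not> good t}"
  have "open {t. good t}"
    unfolding open_dist
  proof (intro ballI)
    fix t assume "t \<in> {t. good t}"
    then obtain \<epsilon> k where \<epsilon>: "\<epsilon> > 0"
      "\<forall>r\<in>{\<alpha>..\<beta>}. \<bar>r - t\<bar> < \<epsilon> \<longrightarrow> (\<forall>N. g N r \<le> k)"
      unfolding good_def by auto
    have "good y" if "dist y t < \<epsilon>/2" for y
      unfolding good_def
    proof (rule exI[of _ "\<epsilon>/2"], intro conjI exI[of _ k] ballI impI)
      fix r assume "r \<in> {\<alpha>..\<beta>}" "\<bar>r - y\<bar> < \<epsilon>/2"
      then have "\<bar>r - t\<bar> < \<epsilon>" using that unfolding dist_real_def by linarith
      then show "\<forall>N. g N r \<le> k" using \<epsilon>(2) \<open>r \<in> _\<close> by blast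
    qed (use \<epsilon> in auto)
    then show "\<exists>e>0. \<forall>y. dist y t < e \<longrightarrow> y \<in> {t. good t}"
      using \<epsilon>(1) by (intro exI[of _ "\<epsilon>/2"]) auto
  qed
  then have "closed P"
    unfolding P_def using closed_Diff[of "{\<alpha>..\<beta>}" "{t. good t}"]
    by (simp add: set_diff_eq)
  show ?thesis
  proof (cases "P = {}")
    case True
    then have "good t" if "t \<in> {\<alpha>..\<beta>}" for t using that by (auto simp: P_def)
    then show ?thesis
      using compact_bound[of \<alpha> \<beta>] by (cases "\<alpha> \<le> \<beta>") auto
  next
    case False
    have "P \<subseteq> {\<alpha>..\<beta>}" by (auto simp: P_def)
    obtain p \<epsilon> k where p: "p \<in> P" "\<epsilon> > 0"
      and pk: "\<And>t N. t \<in> P \<Longrightarrow> \<bar>t - p\<bar> < \<epsilon> \<Longrightarrow> g N t \<le> k"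
      using baire_uniform_bound_somewhere[OF \<open>closed P\<close> False, of g] cont fin \<open>P \<subseteq> _\<close>
      by (metis continuous_on_subset subsetD)
    define \<delta> where "\<delta> = min \<epsilon> h / 3"
    have \<delta>: "0 < \<delta>" "\<delta> < \<epsilon>" "2 * \<delta> < h"
      using \<open>\<epsilon> > 0\<close> \<open>h > 0\<close> by (auto simp: \<delta>_def min_def)
    \<comment> \<open>The set \<open>Q\<close> adds the two ends of a short interval around \<open>p\<close> to the exceptional times in it, so
      that every gap has both ends in \<open>Q\<close>, where \<open>K\<close> bounds the family.\<close>
    define q1 q2 where "q1 = max \<alpha> (p - \<delta>)" and "q2 = min \<beta> (p + \<delta>)"
    have pab: "\<alpha> \<le> p" "p \<le> \<beta>" using p \<open>P \<subseteq> _\<close> by auto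
    then have q: "q1 \<in> {\<alpha>..\<beta>}" "q2 \<in> {\<alpha>..\<beta>}" "q1 \<le> q2" "q2 - q1 \<le> 2 * \<delta>"
      using \<delta> by (auto simp: q1_def q2_def)
    obtain k1 k2 where k12: "\<And>N. g N q1 \<le> k1" "\<And>N. g N q2 \<le> k2"
      using fin[OF q(1)] fin[OF q(2)] by auto
    define K where "K = max k (max k1 k2)"
    define Q where "Q = (P \<inter> {q1..q2}) \<union> {q1, q2}"
    have QK: "g N t \<le> K" if "t \<in> Q" for N t
    proof -
      have "g N t \<le> k" if "t \<in> P" "t \<in> {q1..q2}"
        using pk[OF that(1)] that(2) \<delta> by (auto simp: q1_def q2_def)
      with that k12 show ?thesis
        unfolding Q_def K_def by (auto simp: le_max_iff_disj)
    qed
    have "compact Q"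
      unfolding Q_def using \<open>closed P\<close>
      by (intro compact_Un closed_Int_compact) auto
    obtain C where C: "\<And>a b k. \<lbrakk>\<alpha> \<le> a; a < b; b \<le> \<beta>; b - a < h; \<forall>N. g N a \<le> K; \<forall>N. g N b \<le> K;
        \<forall>t\<in>{a..b}. \<forall>N. g N t \<le> k\<rbrakk> \<Longrightarrow> (\<forall>t\<in>{a..b}. \<forall>N. g N t \<le> C)"
      using ends[of K] by blast
    have bound: "g N r \<le> max K C" if r: "r \<in> {\<alpha>..\<beta>}" "\<bar>r - p\<bar> < \<delta>" for r N
    proof (cases "r \<in> Q")
      case True
      then show ?thesis using QK by (simp add: le_max_iff_disj)
    next
      case False
      have rq: "q1 \<le> r" "r \<le> q2" using r by (auto simp: q1_def q2_def)
      have "q1 \<in> Q" "q2 \<in> Q" by (auto simp: Q_def)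
      obtain a where a: "a \<in> Q" "a \<le> r" "\<And>x. x \<in> Q \<Longrightarrow> x \<le> r \<Longrightarrow> x \<le> a"
        using compact_attains_sup[OF compact_Int_closed[OF \<open>compact Q\<close> closed_atMost[of r]]]
          \<open>q1 \<in> Q\<close> \<open>q1 \<le> r\<close> by (metis Int_iff atMost_iff empty_iff)
      obtain b where b: "b \<in> Q" "r \<le> b" "\<And>x. x \<in> Q \<Longrightarrow> r \<le> x \<Longrightarrow> b \<le> x"
        using compact_attains_inf[OF compact_Int_closed[OF \<open>compact Q\<close> closed_atLeast[of r]]]
          \<open>q2 \<in> Q\<close> \<open>r \<le> q2\<close> by (metis Int_iff atLeast_iff empty_iff)
      have ab: "a < r" "r < b" using a b False by (auto simp: less_le)
      have abq: "q1 \<le> a" "b \<le> q2" using a(1) b(1) q by (auto simp: Q_def)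
      have gd: "good t" if "a < t" "t < b" for t
      proof (rule ccontr)
        assume "\<not> good t"
        then have "t \<in> Q" using that abq q by (auto simp: Q_def P_def)
        then show False using a(3)[of t] b(3)[of t] that by (cases "t \<le> r") auto
      qed
      define s where "s = (a + b) / 2"
      have s: "a < s" "s < b" "s \<in> {\<alpha>..\<beta>}"
        using ab abq q by (auto simp: s_def field_simps)
      obtain C1 where C1: "\<And>a b k. \<lbrakk>\<alpha> \<le> a; a < b; b \<le> \<beta>; b - a < h; s \<in> {a..b};
        \<forall>t\<in>{a..b}. \<forall>N. g N t \<le> k\<rbrakk> \<Longrightarrow> (\<forall>t\<in>{a..b}. \<forall>N. g N t \<le> C1)"
        using interior[OF s(3)] by blast
      have inside: "g N t \<le> C1" if t: "t \<in> {a<..<b}" for t N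
      proof -
        define a' b' where "a' = (a + min t s) / 2" and "b' = (b + max t s) / 2"
        have ab': "a < a'" "a' < b'" "b' < b" "t \<in> {a'..b'}" "s \<in> {a'..b'}"
          using t s unfolding a'_def b'_def by (auto simp: min_def max_def field_simps)
        obtain l where l: "\<forall>t\<in>{a'..b'} \<inter> {\<alpha>..\<beta>}. \<forall>N. g N t \<le> l"
          using compact_bound[of a' b'] gd ab' by fastforce
        have "\<forall>t\<in>{a'..b'}. \<forall>N. g N t \<le> C1"
          by (rule C1[of a' b' l]) (use ab' abq q \<delta> l in auto)
        then show ?thesis using ab' by blast
      qed
      have "\<forall>t\<in>{a..b}. \<forall>N. g N t \<le> C1"
      proof (intro ballI allI)
        fix t N assume "t \<in> {a..b}"
        then have "t \<in> closure {a<..<b}" "closure {a<..<b} = {a..b}" using ab by auto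
        moreover have "continuous_on {a..b} (g N)"
          using abq q by (intro continuous_on_subset[OF cont[of N]]) auto
        ultimately show "g N t \<le> C1"
          using continuous_le_on_closure[of "{a<..<b}" "g N" t C1] inside by auto
      qed
      then have "\<forall>t\<in>{a..b}. \<forall>N. g N t \<le> C"
        by (intro C[of a b C1]) (use a b ab abq q \<delta> QK in auto)
      then show ?thesis using ab by (auto simp: le_max_iff_disj)
    qed
    then have "good p"
      unfolding good_def using \<delta>(1) by blast
    then show ?thesis using p(1) by (auto simp: P_def)
  qed
qed

text \<open>Apply the improvement to the least bound, whose existence is all that the arbitrary bound \<open>k\<close>
  provides.\<close>

lemma bound_by_absorption:
  fixes g :: "'i \<Rightarrow> real"
  assumes "\<And>i. i \<in> I \<Longrightarrow> g i \<le> k" "0 \<le> A"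
    and improve: "\<And>S. 0 \<le> S \<Longrightarrow> (\<And>i. i \<in> I \<Longrightarrow> g i \<le> S) \<Longrightarrow> (\<And>i. i \<in> I \<Longrightarrow> g i \<le> A + S / 2)"
    and "i \<in> I"
  shows "g i \<le> 2 * A"
proof -
  have bdd: "bdd_above (g ` I)" using assms(1) by (auto intro!: bdd_aboveI)
  define S where "S = max 0 (SUP i\<in>I. g i)"
  have "g i \<le> S" if "i \<in> I" for i
    using cSUP_upper[OF that bdd] by (auto simp: S_def)
  then have "g i \<le> A + S / 2" if "i \<in> I" for i using improve[of S] that by (auto simp: S_def)
  then have "(SUP i\<in>I. g i) \<le> A + S / 2" using \<open>i \<in> I\<close> by (intro cSUP_least) auto
  then have "S \<le> 2 * A" using \<open>0 \<le> A\<close> by (auto simp: S_def max_def split: if_splits)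
  moreover have "g i \<le> S" using cSUP_upper[OF \<open>i \<in> I\<close> bdd] by (auto simp: S_def)
  ultimately show ?thesis by linarith
qed

section \<open>Square-summable sequences\<close>

text \<open>Bounds on the \<open>l\<^sup>2\<close> norm are expressed through finite truncations, so that they make sense, and
  can be proved, before square-summability is known.\<close>

definition l2_bounded :: "real \<Rightarrow> (nat \<Rightarrow> real) \<Rightarrow> bool" where
  "l2_bounded B x \<longleftrightarrow> (\<forall>N. L2_set x {..<N} \<le> B)"

lemma l2_boundedD: "l2_bounded B x \<Longrightarrow> L2_set x {..<N} \<le> B"
  by (simp add: l2_bounded_def)

lemma l2_bounded_nonneg: "l2_bounded B x \<Longrightarrow> 0 \<le> B"
  using l2_boundedD[of B x 0] by simp

lemma l2_bounded_mono: "l2_bounded B x \<Longrightarrow> B \<le> C \<Longrightarrow> l2_bounded C x"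
  by (meson l2_bounded_def order_trans)

lemma l2_bounded_add:
  "l2_bounded B x \<Longrightarrow> l2_bounded C y \<Longrightarrow> l2_bounded (B + C) (\<lambda>n. x n + y n)"
  unfolding l2_bounded_def by (intro allI order_trans[OF L2_set_triangle_ineq] add_mono) auto

lemma l2_bounded_dominated:
  assumes "l2_bounded B x" "\<And>n. \<bar>y n\<bar> \<le> K * \<bar>x n\<bar>" "0 \<le> K"
  shows "l2_bounded (K * B) y"
  unfolding l2_bounded_def
proof
  fix N
  have "L2_set y {..<N} = L2_set (\<lambda>n. \<bar>y n\<bar>) {..<N}" by (simp add: L2_set_def)
  also have "\<dots> \<le> L2_set (\<lambda>n. K * \<bar>x n\<bar>) {..<N}" using assms by (intro L2_set_mono) auto
  also have "\<dots> = K * L2_set (\<lambda>n. \<bar>x n\<bar>) {..<N}" using assms by (simp add: L2_set_right_distrib)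
  also have "L2_set (\<lambda>n. \<bar>x n\<bar>) {..<N} = L2_set x {..<N}" by (simp add: L2_set_def)
  also have "K * \<dots> \<le> K * B" using assms by (intro mult_left_mono l2_boundedD)
  finally show "L2_set y {..<N} \<le> K * B" .
qed

lemma l2_bounded_scale: "l2_bounded B x \<Longrightarrow> l2_bounded (\<bar>k\<bar> * B) (\<lambda>n. k * x n)"
  by (rule l2_bounded_dominated) (auto simp: abs_mult)

lemma l2_bounded_diff:
  assumes "l2_bounded B x" "l2_bounded C y"
  shows "l2_bounded (B + C) (\<lambda>n. x n - y n)"
  using l2_bounded_add[OF assms(1) l2_bounded_scale[OF assms(2), of "-1"]] by simp

lemma l2_bounded_Suc: "l2_bounded B x \<Longrightarrow> l2_bounded B (\<lambda>n. x (Suc n))"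
proof (unfold l2_bounded_def, intro allI)
  fix N assume "\<forall>N. L2_set x {..<N} \<le> B"
  then have "L2_set x {..<Suc N} \<le> B" by blast
  moreover have "(\<Sum>n<N. (x (Suc n))\<^sup>2) \<le> (\<Sum>n<Suc N. (x n)\<^sup>2)"
    by (simp only: sum.lessThan_Suc_shift) simp
  ultimately show "L2_set (\<lambda>n. x (Suc n)) {..<N} \<le> B"
    unfolding L2_set_def by (meson order_trans real_sqrt_le_mono)
qed

text \<open>Splits off the entry at \<open>0\<close>: the driven end of the chain obeys no equation of motion.\<close>

lemma l2_bounded_cons:
  assumes "\<bar>x 0\<bar> \<le> D" "l2_bounded B (\<lambda>n. x (Suc n))"
  shows "l2_bounded (D + B) x"
  unfolding l2_bounded_def
proof
  fix N
  show "L2_set x {..<N} \<le> D + B"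
  proof (cases N)
    case 0
    then show ?thesis using assms l2_bounded_nonneg by fastforce
  next
    case (Suc M)
    have "L2_set x {..<N} = sqrt ((x 0)\<^sup>2 + (L2_set (\<lambda>n. x (Suc n)) {..<M})\<^sup>2)"
      unfolding L2_set_def Suc by (simp only: sum.lessThan_Suc_shift) (simp add: sum_nonneg)
    also have "\<dots> \<le> \<bar>x 0\<bar> + L2_set (\<lambda>n. x (Suc n)) {..<M}"
      by (metis L2_set_nonneg abs_of_nonneg sqrt_sum_squares_le_sum_abs)
    finally show ?thesis using assms l2_boundedD by (smt (verit))
  qed
qed

lemma l2_bounded_sum: "l2_bounded B x \<Longrightarrow> (\<Sum>n<N. (x n)\<^sup>2) \<le> B\<^sup>2"
  using l2_boundedD[of B x N] by (simp add: L2_set_def sqrt_le_D)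

lemma l2_boundedI: "(\<And>N. (\<Sum>n<N. (x n)\<^sup>2) \<le> B\<^sup>2) \<Longrightarrow> 0 \<le> B \<Longrightarrow> l2_bounded B x"
  unfolding l2_bounded_def L2_set_def by (simp add: real_le_lsqrt sum_nonneg)

lemma l2_bounded_summable:
  assumes "l2_bounded B x"
  shows "summable (\<lambda>n. (x n)\<^sup>2)" "(\<Sum>n. (x n)\<^sup>2) \<le> B\<^sup>2"
proof -
  show s: "summable (\<lambda>n. (x n)\<^sup>2)"
    using l2_bounded_sum[OF assms] by (intro summableI_nonneg_bounded) auto
  show "(\<Sum>n. (x n)\<^sup>2) \<le> B\<^sup>2"
    using l2_bounded_sum[OF assms] s by (intro suminf_le_const)
qed

lemma summable_l2_bounded:
  assumes "summable (\<lambda>n. (x n :: real)\<^sup>2)"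
  shows "l2_bounded (sqrt (\<Sum>n. (x n)\<^sup>2)) x"
  unfolding l2_bounded_def L2_set_def
  using assms by (intro allI real_sqrt_le_mono sum_le_suminf) auto

lemma l2_bounded_tendsto_0:
  assumes "l2_bounded B x" shows "x \<longlonglongrightarrow> 0"
  using tendsto_real_sqrt[OF summable_LIMSEQ_zero[OF l2_bounded_summable(1)[OF assms]]]
  by (simp add: tendsto_rabs_zero_iff)

lemma l2_bounded_prod:
  assumes "l2_bounded B x" "l2_bounded C y"
  shows "summable (\<lambda>n. x n * y n)" "\<bar>\<Sum>n. x n * y n\<bar> \<le> B * C"
proof -
  have le: "(\<Sum>n<N. \<bar>x n * y n\<bar>) \<le> B * C" for N
  proof -
    have "(\<Sum>n<N. \<bar>x n * y n\<bar>) \<le> L2_set x {..<N} * L2_set y {..<N}"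
      using L2_set_mult_ineq[of x y "{..<N}"] by (simp add: abs_mult)
    also have "\<dots> \<le> B * C"
      using assms l2_boundedD l2_bounded_nonneg by (intro mult_mono) auto
    finally show ?thesis .
  qed
  have s: "summable (\<lambda>n. \<bar>x n * y n\<bar>)"
    using le by (intro summableI_nonneg_bounded) auto
  then show "summable (\<lambda>n. x n * y n)" by (rule summable_rabs_cancel)
  show "\<bar>\<Sum>n. x n * y n\<bar> \<le> B * C"
    using summable_rabs[OF s] suminf_le_const[OF s le] by linarith
qed

text \<open>The mean value inequality for curves in \<open>l\<^sup>2\<close>, by pairing with the increment itself.\<close>

lemma l2_bounded_increment:
  fixes y y' :: "nat \<Rightarrow> real \<Rightarrow> real"
  assumes deriv: "\<And>n r. r \<in> closed_segment s t \<Longrightarrow>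
      (y n has_real_derivative y' n r) (at r within closed_segment s t)"
    and bound: "\<And>r. r \<in> closed_segment s t \<Longrightarrow> l2_bounded B (\<lambda>n. y' n r)"
  shows "l2_bounded (B * \<bar>t - s\<bar>) (\<lambda>n. y n t - y n s)"
  unfolding l2_bounded_def
proof
  fix N
  define \<xi> where "\<xi> n = y n t - y n s" for n
  define \<Xi> where "\<Xi> = L2_set \<xi> {..<N}"
  have "norm ((\<Sum>n<N. \<xi> n * y n t) - (\<Sum>n<N. \<xi> n * y n s)) \<le> (\<Xi> * B) * norm (t - s)"
  proof (rule field_differentiable_bound[where S = "closed_segment s t"
        and f' = "\<lambda>r. \<Sum>n<N. \<xi> n * y' n r"])
    fix r assume r: "r \<in> closed_segment s t"
    show "((\<lambda>r. \<Sum>n<N. \<xi> n * y n r) has_real_derivative (\<Sum>n<N. \<xi> n * y' n r))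
        (at r within closed_segment s t)"
      using deriv[OF r] by (auto intro!: derivative_eq_intros simp: mult.commute)
    have "\<bar>\<Sum>n<N. \<xi> n * y' n r\<bar> \<le> (\<Sum>n<N. \<bar>\<xi> n\<bar> * \<bar>y' n r\<bar>)"
      by (metis (no_types, lifting) abs_mult sum_abs sum.cong)
    also have "\<dots> \<le> \<Xi> * L2_set (\<lambda>n. y' n r) {..<N}"
      unfolding \<Xi>_def by (rule L2_set_mult_ineq)
    also have "\<dots> \<le> \<Xi> * B"
      using l2_boundedD[OF bound[OF r]] by (intro mult_left_mono) (auto simp: \<Xi>_def)
    finally show "norm (\<Sum>n<N. \<xi> n * y' n r) \<le> \<Xi> * B" by simp
  qed auto
  also have "(\<Sum>n<N. \<xi> n * y n t) - (\<Sum>n<N. \<xi> n * y n s) = (\<Sum>n<N. (\<xi> n)\<^sup>2)"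
    by (simp add: \<xi>_def power2_eq_square right_diff_distrib flip: sum_subtractf)
  also have "\<dots> = \<Xi> * \<Xi>"
    by (simp add: \<Xi>_def L2_set_def sum_nonneg)
  finally have "\<Xi> * \<Xi> \<le> \<Xi> * (B * \<bar>t - s\<bar>)" by (simp add: mult.assoc)
  moreover have "0 \<le> \<Xi>" "0 \<le> B" using bound[of s] l2_bounded_nonneg by (auto simp: \<Xi>_def)
  ultimately have "\<Xi> \<le> B * \<bar>t - s\<bar>"
    by (cases "\<Xi> = 0") (simp_all add: mult_le_cancel_left)
  then show "L2_set (\<lambda>n. y n t - y n s) {..<N} \<le> B * \<bar>t - s\<bar>"
    by (simp add: \<Xi>_def \<xi>_def[abs_def])
qed

section \<open>Chains that escape to infinity\<close>

lemma null_times_bounded: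
  fixes z b :: "nat \<Rightarrow> real"
  assumes "z \<longlonglongrightarrow> 0" "\<And>n. \<bar>b n\<bar> \<le> K"
  shows "(\<lambda>n. b n * z n) \<longlonglongrightarrow> 0"
proof (rule tendsto_0_le[OF assms(1)])
  show "\<forall>\<^sub>F n in sequentially. norm (b n * z n) \<le> norm (z n) * K"
    using assms(2) by (intro always_eventually allI) (simp add: abs_mult mult_right_mono mult.commute[of _ K])
qed

lemma convergent_abs_bound:
  fixes x :: "nat \<Rightarrow> real"
  assumes "x \<longlonglongrightarrow> l"
  obtains K where "\<And>n. \<bar>x n\<bar> \<le> K"
proof -
  obtain K where "\<forall>n. norm (x n) \<le> K"
    using convergent_imp_Bseq[OF convergentI[OF assms]] by (rule BseqE)
  then show thesis by (intro that[of K]) simp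
qed

text \<open>The nearest multiples of \<open>\<pi>\<close> are eventually exact negatives of their predecessors, so their
  absolute values are eventually constant.\<close>

lemma alternating_near_sin_zeros_not_at_top:
  fixes y :: "nat \<Rightarrow> real"
  assumes alt: "(\<lambda>n. y (Suc n) + y n) \<longlonglongrightarrow> 0" and sin: "(\<lambda>n. sin (y n)) \<longlonglongrightarrow> 0"
  shows "\<not> filterlim (\<lambda>n. \<bar>y n\<bar>) at_top sequentially"
proof
  assume top: "filterlim (\<lambda>n. \<bar>y n\<bar>) at_top sequentially"
  define k where "k n = round (y n / pi)" for n
  define d where "d n = y n - pi * of_int (k n)" for n
  have d_bound: "\<bar>d n\<bar> \<le> pi / 2" for n
  proof -
    have "\<bar>y n / pi - of_int (k n)\<bar> \<le> 1 / 2"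
      unfolding k_def using of_int_round_abs_le[of "y n / pi"] by (simp add: abs_minus_commute)
    moreover have "d n = pi * (y n / pi - of_int (k n))"
      by (simp add: d_def right_diff_distrib)
    ultimately show ?thesis by (simp add: abs_mult mult.commute)
  qed
  have "\<bar>sin (d n)\<bar> = \<bar>sin (y n)\<bar>" for n
  proof -
    have "sin (pi * of_int (k n)) = 0" by (simp add: mult.commute sin_times_pi_eq_0)
    moreover from this have "\<bar>cos (pi * of_int (k n))\<bar> = 1"
      using sin_zero_abs_cos_one by blast
    ultimately show ?thesis by (simp add: d_def sin_diff abs_mult)
  qed
  then have "(\<lambda>n. sin (d n)) \<longlonglongrightarrow> 0"
    using tendsto_rabs_zero[OF sin] by (intro tendsto_rabs_zero_cancel[of "\<lambda>n. sin (d n)"]) simp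
  then have "(\<lambda>n. arcsin (sin (d n))) \<longlonglongrightarrow> arcsin 0"
    by (intro isCont_tendsto_compose[OF isCont_arcsin]) auto
  moreover have "arcsin (sin (d n)) = d n" for n
    using d_bound[of n] by (intro arcsin_sin) auto
  ultimately have d0: "d \<longlonglongrightarrow> 0" by simp
  have "(\<lambda>n. (y (Suc n) + y n) - (d (Suc n) + d n)) \<longlonglongrightarrow> 0 - (0 + 0)"
    by (intro tendsto_diff alt tendsto_add d0 LIMSEQ_Suc)
  then have "(\<lambda>n. pi * of_int (k (Suc n) + k n)) \<longlonglongrightarrow> 0"
    by (simp add: d_def algebra_simps)
  then have "\<forall>\<^sub>F n in sequentially. \<bar>pi * of_int (k (Suc n) + k n)\<bar> < pi"
    by (drule_tac tendstoD[OF _ pi_gt_zero]) (simp only: dist_real_def diff_0_right)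
  then obtain N where N: "\<And>n. n \<ge> N \<Longrightarrow> \<bar>pi * of_int (k (Suc n) + k n)\<bar> < pi"
    unfolding eventually_sequentially by blast
  have opp: "k (Suc n) = - k n" if "n \<ge> N" for n
  proof -
    have "\<bar>of_int (k (Suc n) + k n)\<bar> < (1::real)"
      using N[OF that] unfolding abs_mult using pi_gt_zero
      by (metis abs_of_pos mult.right_neutral mult_less_cancel_left_pos)
    then have "\<bar>k (Suc n) + k n\<bar> < 1" by (metis of_int_abs of_int_less_1_iff)
    then show ?thesis by simp
  qed
  have "\<bar>k n\<bar> = \<bar>k N\<bar>" if "n \<ge> N" for n
    using that by (induction rule: dec_induct) (auto simp: opp)
  then have "\<bar>y n\<bar> \<le> pi * \<bar>of_int (k N)\<bar> + pi / 2" if "n \<ge> N" for n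
  proof -
    have "y n = pi * of_int (k n) + d n" by (simp add: d_def)
    then have "\<bar>y n\<bar> \<le> pi * \<bar>of_int (k n)\<bar> + \<bar>d n\<bar>"
      by (metis abs_mult abs_of_pos abs_triangle_ineq pi_gt_zero)
    moreover have "\<bar>of_int (k n) :: real\<bar> = \<bar>of_int (k N)\<bar>"
      using \<open>\<And>n. N \<le> n \<Longrightarrow> \<bar>k n\<bar> = \<bar>k N\<bar>\<close>[OF that] by (metis of_int_abs)
    ultimately show ?thesis using d_bound[of n] by simp
  qed
  moreover obtain M where "\<And>n. n \<ge> M \<Longrightarrow> \<bar>y n\<bar> > pi * \<bar>of_int (k N)\<bar> + pi / 2"
    using top unfolding filterlim_at_top_dense eventually_sequentially by blast
  ultimately show False
    by (metis linorder_not_less nat_le_linear)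
qed

text \<open>Suppose the increments escape; then so do the \<open>x n\<close>, and for the ratios \<open>r n = x (n + 1) / x n\<close> and
  \<open>q = \<mu> / C\<close> the bounded sine and cosine terms drop out in the limit. The energy at \<open>n\<close> becomes
  \<open>(r - 1)\<^sup>2 \<rightarrow> q\<close>, and the energy at \<open>n + 1\<close>, rewritten with the recurrence given by the force,
  becomes \<open>((1 - q) r - 1)\<^sup>2 - q r\<^sup>2 \<rightarrow> 0\<close>. Eliminating the linear term in \<open>r\<close> leaves
  \<open>q (q - 2) (r\<^sup>2 - 1) \<rightarrow> 0\<close>. If \<open>q \<noteq> 2\<close>, this forces \<open>q = 4\<close> and \<open>r \<rightarrow> -1\<close>. In both cases
  \<open>q = 4\<close> and \<open>q = 2\<close>, a closer look at the energy, which is a product with one factor of the size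
  of \<open>x\<close>, shows that \<open>x (n + 1) + x n\<close>, respectively \<open>x (n + 2) + x n\<close>, tends to zero. The force
  then gives \<open>sin (x n) \<rightarrow> 0\<close>, so the sequence stays bounded along every, respectively every other,
  index.\<close>

lemma sine_gordon_increments_not_at_top:
  fixes x :: "nat \<Rightarrow> real"
  assumes "0 < C" "0 < \<mu>"
    and energy: "(\<lambda>n. C * (x (Suc n) - x n)\<^sup>2 - \<mu> * (x n)\<^sup>2 + 2 * (1 - cos (x n))) \<longlonglongrightarrow> 0"
    and force: "(\<lambda>n. C * (x (Suc (Suc n)) - 2 * x (Suc n) + x n) + \<mu> * x (Suc n) - sin (x (Suc n)))
      \<longlonglongrightarrow> 0"
  shows "\<not> filterlim (\<lambda>n. \<bar>x (Suc n) - x n\<bar>) at_top sequentially"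
proof
  assume top: "filterlim (\<lambda>n. \<bar>x (Suc n) - x n\<bar>) at_top sequentially"
  define p where "p n = 2 * (1 - cos (x n))" for n
  define A where "A n = C * (x (Suc n) - x n)\<^sup>2 - \<mu> * (x n)\<^sup>2 + p n" for n
  define B where "B n = C * (x (Suc (Suc n)) - 2 * x (Suc n) + x n) + \<mu> * x (Suc n) - sin (x (Suc n))" for n
  have A0: "A \<longlonglongrightarrow> 0" and B0: "B \<longlonglongrightarrow> 0"
    using energy force by (simp_all add: A_def[abs_def] B_def[abs_def] p_def)
  obtain KA where KA: "\<And>n. \<bar>A n\<bar> \<le> KA" using convergent_abs_bound[OF A0] by blast
  obtain KB where KB: "\<And>n. \<bar>B n\<bar> \<le> KB" using convergent_abs_bound[OF B0] by blast
  have p_bound: "\<bar>p n\<bar> \<le> 4" for n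
    using cos_ge_minus_one[of "x n"] cos_le_one[of "x n"] unfolding p_def abs_le_iff by argo
  have Ap: "\<bar>(A n - p n) / C\<bar> \<le> (KA + 4) / C" for n
    using KA[of n] p_bound[of n] \<open>0 < C\<close> by (simp add: abs_divide divide_right_mono)
  define q where "q = \<mu> / C"
  have "q > 0" and \<mu>: "\<mu> = q * C" using assms(1,2) by (simp_all add: q_def)
  \<comment> \<open>the bounded inhomogeneity of the linear recurrence satisfied by \<open>x\<close>\<close>
  define \<sigma> where "\<sigma> n = (B n + sin (x (Suc n))) / C" for n
  have \<sigma>_bound: "\<bar>\<sigma> n\<bar> \<le> (KB + 1) / C" for n
  proof -
    have "\<bar>B n + sin (x (Suc n))\<bar> \<le> KB + 1"
      using KB[of n] abs_sin_le_one[of "x (Suc n)"] by linarith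
    then show ?thesis using \<open>0 < C\<close> by (simp add: \<sigma>_def abs_divide divide_right_mono)
  qed
  have rec: "x (Suc (Suc n)) = (2 - q) * x (Suc n) - x n + \<sigma> n" for n
    using \<open>0 < C\<close> by (simp add: \<sigma>_def B_def \<mu> field_simps)
  have quad: "(x (Suc n) - x n)\<^sup>2 - q * (x n)\<^sup>2 = (A n - p n) / C" for n
    using \<open>0 < C\<close> by (simp add: A_def \<mu> field_simps)
  have x_top: "filterlim (\<lambda>n. \<bar>x n\<bar>) at_top sequentially"
    unfolding filterlim_at_top
  proof
    fix Z
    have "\<forall>\<^sub>F n in sequentially. \<bar>x (Suc n) - x n\<bar> \<ge> sqrt (q * Z\<^sup>2 + (KA + 4) / C)"
      using top by (simp add: filterlim_at_top)
    then show "\<forall>\<^sub>F n in sequentially. Z \<le> \<bar>x n\<bar>"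
    proof eventually_elim
      case (elim n)
      then have "(x (Suc n) - x n)\<^sup>2 \<ge> q * Z\<^sup>2 + (KA + 4) / C"
        by (metis real_sqrt_abs real_sqrt_le_iff)
      with quad[of n] Ap[of n] have "q * Z\<^sup>2 \<le> q * (x n)\<^sup>2" by linarith
      then have "\<bar>Z\<bar> \<le> \<bar>x n\<bar>" using \<open>q > 0\<close> by (simp add: abs_le_square_iff)
      then show ?case by simp
    qed
  qed
  define i where "i n = inverse (x n)" for n
  have i0: "i \<longlonglongrightarrow> 0"
    using tendsto_inverse_0_at_top[OF x_top] 
    by (intro tendsto_rabs_zero_cancel[of i]) (simp add: i_def)
  have nz: "\<forall>\<^sub>F n in sequentially. x n * i n = 1"
    using filterlim_at_top_dense[THEN iffD1, OF x_top, rule_format, of 0]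
    by eventually_elim (simp add: i_def)
  have ii0: "(\<lambda>n. i n * i n) \<longlonglongrightarrow> 0" using tendsto_mult[OF i0 i0] by simp
  define r where "r n = x (Suc n) * i n" for n
  have r1: "(\<lambda>n. (r n - 1)\<^sup>2) \<longlonglongrightarrow> q"
  proof -
    have "(\<lambda>n. (A n - p n) / C * (i n * i n)) \<longlonglongrightarrow> 0"
      by (rule null_times_bounded[OF ii0 Ap])
    moreover have "\<forall>\<^sub>F n in sequentially. (A n - p n) / C * (i n * i n) = (r n - 1)\<^sup>2 - q"
      using nz
    proof eventually_elim
      case (elim n)
      have "(A n - p n) / C * (i n * i n)
          = (x (Suc n) * i n - x n * i n)\<^sup>2 - q * (x n * i n)\<^sup>2"
        unfolding quad[symmetric] by (simp add: power2_eq_square algebra_simps)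
      then show ?case using elim by (simp add: r_def)
    qed
    ultimately have "(\<lambda>n. (r n - 1)\<^sup>2 - q) \<longlonglongrightarrow> 0"
      by (rule Lim_transform_eventually)
    then show ?thesis by (simp add: LIM_zero_iff)
  qed
  obtain K where K: "\<And>n. \<bar>r n\<bar> \<le> K"
  proof -
    obtain K0 where K0: "\<And>n. \<bar>(r n - 1)\<^sup>2\<bar> \<le> K0" using convergent_abs_bound[OF r1] by blast
    have "\<bar>r n\<bar> \<le> K0 + 2" for n
    proof -
      have "2 * \<bar>r n - 1\<bar> \<le> (r n - 1)\<^sup>2 + 1"
        using zero_le_power2[of "\<bar>r n - 1\<bar> - 1"] by (simp add: power2_diff)
      then show ?thesis using K0[of n] by (simp add: abs_if split: if_splits)
    qed
    then show thesis by (rule that)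
  qed
  have "(\<lambda>n. q * (q - 2) * ((r n)\<^sup>2 - 1)) \<longlonglongrightarrow> 0"
  proof -
    define e where "e n = \<sigma> n * i n" for n
    have e0: "e \<longlonglongrightarrow> 0"
      unfolding e_def[abs_def] by (rule null_times_bounded[OF i0 \<sigma>_bound])
    obtain Ke where Ke: "\<And>n. \<bar>e n\<bar> \<le> Ke" using convergent_abs_bound[OF e0] by blast
    have z1: "(\<lambda>n. (A (Suc n) - p (Suc n)) / C * (i n * i n)) \<longlonglongrightarrow> 0"
      by (rule null_times_bounded[OF ii0 Ap])
    obtain M where M: "\<And>n. \<bar>(1 - q) * r n\<bar> \<le> M"
    proof
      show "\<bar>(1 - q) * r n\<bar> \<le> \<bar>1 - q\<bar> * K" for n
        using K[of n] by (simp add: abs_mult mult_left_mono)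
    qed
    have "\<bar>2 * (a - 1) + b\<bar> \<le> 2 * (M + 1) + Ke" if "\<bar>a\<bar> \<le> M" "\<bar>b\<bar> \<le> Ke" for a b :: real
      using that unfolding abs_le_iff by argo
    then have "\<bar>2 * ((1 - q) * r n - 1) + e n\<bar> \<le> 2 * (M + 1) + Ke" for n
      using M Ke by blast
    from null_times_bounded[OF e0 this]
    have z2: "(\<lambda>n. (2 * ((1 - q) * r n - 1) + e n) * e n) \<longlonglongrightarrow> 0" .
    have z3: "(\<lambda>n. (1 - q) * ((r n - 1)\<^sup>2 - q)) \<longlonglongrightarrow> 0"
      using r1 by (intro tendsto_mult_right_zero) (simp add: LIM_zero_iff)
    have "(\<lambda>n. (A (Suc n) - p (Suc n)) / C * (i n * i n)
        - (2 * ((1 - q) * r n - 1) + e n) * e n - (1 - q) * ((r n - 1)\<^sup>2 - q)) \<longlonglongrightarrow> 0"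
      using tendsto_diff[OF tendsto_diff[OF z1 z2] z3] by simp
    moreover have "\<forall>\<^sub>F n in sequentially. (A (Suc n) - p (Suc n)) / C * (i n * i n)
        - (2 * ((1 - q) * r n - 1) + e n) * e n - (1 - q) * ((r n - 1)\<^sup>2 - q)
        = q * (q - 2) * ((r n)\<^sup>2 - 1)"
      using nz
    proof eventually_elim
      case (elim n)
      have "x (Suc (Suc n)) * i n = (2 - q) * (x (Suc n) * i n) - x n * i n + \<sigma> n * i n"
        unfolding rec[of n] by (simp add: algebra_simps)
      then have t: "x (Suc (Suc n)) * i n = (2 - q) * r n - 1 + e n"
        using elim by (simp add: r_def e_def)
      have "(A (Suc n) - p (Suc n)) / C * (i n * i n)
          = (x (Suc (Suc n)) * i n - x (Suc n) * i n)\<^sup>2 - q * (x (Suc n) * i n)\<^sup>2"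
        unfolding quad[symmetric] by (simp add: power2_eq_square algebra_simps)
      also have "\<dots> = ((2 - q) * r n - 1 + e n - r n)\<^sup>2 - q * (r n)\<^sup>2"
        by (simp only: t r_def)
      finally show ?case
        by (simp add: power2_eq_square algebra_simps)
    qed
    ultimately show ?thesis by (rule Lim_transform_eventually)
  qed
  then have dichotomy: "q = 2 \<or> (\<lambda>n. (r n)\<^sup>2) \<longlonglongrightarrow> 1"
  proof (cases "q = 2")
    case False
    then have nonzero: "q * (q - 2) \<noteq> 0" using \<open>q > 0\<close> by simp
    have "(\<lambda>n. q * (q - 2) * ((r n)\<^sup>2 - 1) / (q * (q - 2))) \<longlonglongrightarrow> 0 / (q * (q - 2))"
      by (rule tendsto_divide[OF \<open>(\<lambda>n. q * (q - 2) * ((r n)\<^sup>2 - 1)) \<longlonglongrightarrow> 0\<close> tendsto_const nonzero])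
    then have "(\<lambda>n. (r n)\<^sup>2 - 1) \<longlonglongrightarrow> 0"
      using nonzero by simp
    then show ?thesis by (simp add: LIM_zero_iff)
  qed simp
  show False
  proof (cases "q = 2")
    case False
    with dichotomy have r2: "(\<lambda>n. (r n)\<^sup>2) \<longlonglongrightarrow> 1" by blast
    have "(\<lambda>n. ((r n)\<^sup>2 + 1 - (r n - 1)\<^sup>2) / 2) \<longlonglongrightarrow> (1 + 1 - q) / 2"
      by (intro tendsto_intros r1 r2) simp
    then have r_lim: "r \<longlonglongrightarrow> (2 - q) / 2"
      by (simp add: power2_eq_square algebra_simps)
    then have "((2 - q) / 2)\<^sup>2 = 1"
      using LIMSEQ_unique[OF tendsto_power[OF r_lim, of 2] r2] by simp
    then have "q * (q - 4) = 0" by (simp add: power2_eq_square field_simps)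
    then have "q = 4" using \<open>q > 0\<close> by simp
    define y where "y n = x (Suc n) + x n" for n
    have "(\<lambda>n. (A n - p n) / C * i n / (r n - 3)) \<longlonglongrightarrow> 0 / ((2 - q) / 2 - 3)"
      using \<open>q = 4\<close> by (intro tendsto_divide tendsto_diff null_times_bounded[OF i0 Ap] r_lim) auto
    moreover have "\<forall>\<^sub>F n in sequentially. (A n - p n) / C * i n / (r n - 3) = y n"
    proof -
      have "\<forall>\<^sub>F n in sequentially. r n < 3"
        using r_lim \<open>q = 4\<close> by (intro order_tendstoD) auto
      with nz show ?thesis
      proof eventually_elim
        case (elim n)
        have "(A n - p n) / C * i n = y n * (x (Suc n) * i n - 3 * (x n * i n))"
          unfolding quad[symmetric] \<open>q = 4\<close> by (simp add: y_def power2_eq_square algebra_simps)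
        then show ?case using elim by (simp add: r_def)
      qed
    qed
    ultimately have y0: "y \<longlonglongrightarrow> 0" using Lim_transform_eventually by fastforce
    have "(\<lambda>n. C * (y (Suc n) + y n) - B n) \<longlonglongrightarrow> C * (0 + 0) - 0"
      by (intro tendsto_intros LIMSEQ_Suc y0 B0)
    then have "(\<lambda>n. sin (x (Suc n))) \<longlonglongrightarrow> 0"
      by (simp add: y_def B_def \<mu> \<open>q = 4\<close> algebra_simps)
    moreover have "(\<lambda>n. x (Suc (Suc n)) + x (Suc n)) \<longlonglongrightarrow> 0"
      using LIMSEQ_Suc[OF y0] by (simp add: y_def)
    ultimately show False
      using alternating_near_sin_zeros_not_at_top[of "\<lambda>n. x (Suc n)"]
        filterlim_compose[OF x_top filterlim_Suc] by blast
  next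
    case True
    have \<sigma>_eq: "\<sigma> n = x (Suc (Suc n)) + x n" for n using rec[of n] True by simp
    \<comment> \<open>Without their cosine terms, the energies at \<open>n\<close> and \<open>n + 1\<close> add up to \<open>C * \<sigma> n\<close> times
      a factor whose ratio to \<open>x n\<close> need not converge; multiplying by \<open>3 - r n\<close> repairs this, since
      \<open>(2 + 2 r) (3 - r) = 2 (4 - (r - 1)\<^sup>2)\<close> tends to \<open>4\<close>.\<close>
    define z where "z n = (\<sigma> n * i n - 2 - 2 * r n) * (3 - r n)" for n
    have "\<bar>3 - r n\<bar> \<le> 3 + K" for n using K[of n] by linarith
    from null_times_bounded[OF null_times_bounded[OF i0 \<sigma>_bound] this]
    have "(\<lambda>n. (3 - r n) * (\<sigma> n * i n) - 2 * (4 - (r n - 1)\<^sup>2)) \<longlonglongrightarrow> 0 - 2 * (4 - q)"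
      by (intro tendsto_intros r1)
    then have z_lim: "z \<longlonglongrightarrow> -4"
      using True by (simp add: z_def[abs_def] power2_eq_square algebra_simps)
    have "\<bar>(A (Suc n) - p (Suc n)) / C + (A n - p n) / C\<bar> \<le> (KA + 4) / C + (KA + 4) / C" for n
      by (rule order_trans[OF abs_triangle_ineq add_mono[OF Ap Ap]])
    moreover have "0 \<le> K" using K[of 0] by linarith
    ultimately have "\<bar>(3 - r n) * ((A (Suc n) - p (Suc n)) / C + (A n - p n) / C)\<bar>
        \<le> (3 + K) * ((KA + 4) / C + (KA + 4) / C)" for n
      unfolding abs_mult using \<open>\<And>n. \<bar>3 - r n\<bar> \<le> 3 + K\<close> by (intro mult_mono) auto
    then have num0: "(\<lambda>n. (3 - r n) * ((A (Suc n) - p (Suc n)) / C + (A n - p n) / C) * i n) \<longlonglongrightarrow> 0"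
      by (rule null_times_bounded[OF i0])
    have "(\<lambda>n. (3 - r n) * ((A (Suc n) - p (Suc n)) / C + (A n - p n) / C) * i n / z n) \<longlonglongrightarrow> 0 / (-4)"
      by (intro tendsto_divide num0 z_lim) auto
    moreover have "\<forall>\<^sub>F n in sequentially.
        (3 - r n) * ((A (Suc n) - p (Suc n)) / C + (A n - p n) / C) * i n / z n = \<sigma> n"
    proof -
      have "\<forall>\<^sub>F n in sequentially. z n < 0"
        using z_lim by (intro order_tendstoD) auto
      with nz show ?thesis
      proof eventually_elim
        case (elim n)
        have "(A (Suc n) - p (Suc n)) / C + (A n - p n) / C = \<sigma> n * (\<sigma> n - 2 * x n - 2 * x (Suc n))"
          unfolding quad[symmetric] \<sigma>_eq True by (simp add: power2_eq_square algebra_simps)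
        then have "((A (Suc n) - p (Suc n)) / C + (A n - p n) / C) * i n
          = \<sigma> n * (\<sigma> n * i n - 2 * (x n * i n) - 2 * (x (Suc n) * i n))"
          by (simp only:) (simp add: algebra_simps)
        then have "(3 - r n) * ((A (Suc n) - p (Suc n)) / C + (A n - p n) / C) * i n = \<sigma> n * z n"
          using elim by (simp add: z_def r_def)
        then show ?case using elim by simp
      qed
    qed
    ultimately have \<sigma>0: "\<sigma> \<longlonglongrightarrow> 0" using Lim_transform_eventually by fastforce
    have "(\<lambda>n. C * \<sigma> n - B n) \<longlonglongrightarrow> C * 0 - 0" by (intro tendsto_intros \<sigma>0 B0)
    moreover have "C * \<sigma> n - B n = sin (x (Suc n))" for n
      using \<open>0 < C\<close> by (simp add: \<sigma>_def)
    ultimately have sin0: "(\<lambda>n. sin (x (Suc n))) \<longlonglongrightarrow> 0" by simp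
    have sub: "filterlim (\<lambda>n. 2 * n) sequentially sequentially"
      "filterlim (\<lambda>n. Suc (2 * n)) sequentially sequentially"
      by (auto intro!: filterlim_subseq simp: strict_mono_def)
    have "(\<lambda>n. sin (x (Suc (2 * n)))) \<longlonglongrightarrow> 0"
      by (rule filterlim_compose[OF sin0 sub(1)])
    moreover have "(\<lambda>n. x (Suc (2 * Suc n)) + x (Suc (2 * n))) \<longlonglongrightarrow> 0"
      using filterlim_compose[OF \<sigma>0 sub(2)] by (simp add: \<sigma>_eq)
    ultimately show False
      using alternating_near_sin_zeros_not_at_top[of "\<lambda>n. x (Suc (2 * n))"]
        filterlim_compose[OF x_top sub(2)] by blast
  qed
qed

section \<open>Curves of square-summable sequences\<close>

text \<open>Continuity and differentiability in the \<open>l\<^sup>2\<close> norm. Only increments are required to be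
  square-summable, since the positions \<open>u\<close> themselves need not be.\<close>

definition l2_continuous_at :: "real set \<Rightarrow> real \<Rightarrow> (nat \<Rightarrow> real \<Rightarrow> real) \<Rightarrow> bool" where
  "l2_continuous_at I s y \<longleftrightarrow>
    (\<forall>e>0. \<exists>\<delta>>0. \<forall>t\<in>I. \<bar>t - s\<bar> < \<delta> \<longrightarrow> l2_bounded e (\<lambda>n. y n t - y n s))"

definition l2_derivative_at :: "real set \<Rightarrow> real \<Rightarrow> (nat \<Rightarrow> real \<Rightarrow> real) \<Rightarrow> (nat \<Rightarrow> real) \<Rightarrow> bool" where
  "l2_derivative_at I s y y' \<longleftrightarrow>
    (\<forall>e>0. \<exists>\<delta>>0. \<forall>t\<in>I. \<bar>t - s\<bar> < \<delta> \<longrightarrow>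
      l2_bounded (e * \<bar>t - s\<bar>) (\<lambda>n. y n t - y n s - (t - s) * y' n))"

lemma l2_continuous_atE:
  assumes "l2_continuous_at I s y" "e > 0"
  obtains \<delta> where "\<delta> > 0" "\<And>t. t \<in> I \<Longrightarrow> \<bar>t - s\<bar> < \<delta> \<Longrightarrow> l2_bounded e (\<lambda>n. y n t - y n s)"
  using assms unfolding l2_continuous_at_def by blast

lemma l2_derivative_atE:
  assumes "l2_derivative_at I s y y'" "e > 0"
  obtains \<delta> where "\<delta> > 0" "\<And>t. t \<in> I \<Longrightarrow> \<bar>t - s\<bar> < \<delta> \<Longrightarrow>
      l2_bounded (e * \<bar>t - s\<bar>) (\<lambda>n. y n t - y n s - (t - s) * y' n)"
  using assms unfolding l2_derivative_at_def by blast

lemma l2_continuous_at_Lipschitz: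
  assumes "\<And>t. t \<in> I \<Longrightarrow> l2_bounded (B * \<bar>t - s\<bar>) (\<lambda>n. y n t - y n s)"
  shows "l2_continuous_at I s y"
  unfolding l2_continuous_at_def
proof (intro allI impI)
  fix e :: real assume "e > 0"
  show "\<exists>\<delta>>0. \<forall>t\<in>I. \<bar>t - s\<bar> < \<delta> \<longrightarrow> l2_bounded e (\<lambda>n. y n t - y n s)"
  proof (intro exI[of _ "e / (\<bar>B\<bar> + 1)"] conjI ballI impI)
    fix t assume t: "t \<in> I" "\<bar>t - s\<bar> < e / (\<bar>B\<bar> + 1)"
    have "B * \<bar>t - s\<bar> \<le> (\<bar>B\<bar> + 1) * \<bar>t - s\<bar>" by (intro mult_right_mono) auto
    also have "\<dots> \<le> e" using t(2) by (simp add: field_simps)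
    finally show "l2_bounded e (\<lambda>n. y n t - y n s)"
      by (rule l2_bounded_mono[OF assms[OF t(1)]])
  qed (use \<open>e > 0\<close> in auto)
qed

lemma l2_continuous_at_add:
  assumes "l2_continuous_at I s y" "l2_continuous_at I s z"
  shows "l2_continuous_at I s (\<lambda>n t. y n t + z n t)"
  unfolding l2_continuous_at_def
proof (intro allI impI)
  fix e :: real assume "e > 0"
  then have "e / 2 > 0" by simp
  obtain \<delta>1 where \<delta>1: "\<delta>1 > 0"
    "\<And>t. t \<in> I \<Longrightarrow> \<bar>t - s\<bar> < \<delta>1 \<Longrightarrow> l2_bounded (e/2) (\<lambda>n. y n t - y n s)"
    using l2_continuous_atE[OF assms(1) \<open>e / 2 > 0\<close>] by blast
  obtain \<delta>2 where \<delta>2: "\<delta>2 > 0"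
    "\<And>t. t \<in> I \<Longrightarrow> \<bar>t - s\<bar> < \<delta>2 \<Longrightarrow> l2_bounded (e/2) (\<lambda>n. z n t - z n s)"
    using l2_continuous_atE[OF assms(2) \<open>e / 2 > 0\<close>] by blast
  have "l2_bounded e (\<lambda>n. y n t + z n t - (y n s + z n s))"
    if "t \<in> I" "\<bar>t - s\<bar> < min \<delta>1 \<delta>2" for t
    using l2_bounded_add[OF \<delta>1(2)[of t] \<delta>2(2)[of t]] that by (simp add: algebra_simps)
  then show "\<exists>\<delta>>0. \<forall>t\<in>I. \<bar>t - s\<bar> < \<delta> \<longrightarrow> l2_bounded e (\<lambda>n. y n t + z n t - (y n s + z n s))"
    using \<delta>1(1) \<delta>2(1) by (intro exI[of _ "min \<delta>1 \<delta>2"]) auto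
qed

lemma l2_continuous_at_cons:
  assumes "continuous (at s within I) (y 0)" "l2_continuous_at I s (\<lambda>n. y (Suc n))"
  shows "l2_continuous_at I s y"
  unfolding l2_continuous_at_def
proof (intro allI impI)
  fix e :: real assume "e > 0"
  obtain \<delta>1 where \<delta>1: "\<delta>1 > 0" "\<And>t. t \<in> I \<Longrightarrow> \<bar>t - s\<bar> < \<delta>1 \<Longrightarrow> \<bar>y 0 t - y 0 s\<bar> < e / 2"
    using assms(1) half_gt_zero[OF \<open>e > 0\<close>] unfolding continuous_within_eps_delta dist_real_def by blast
  obtain \<delta>2 where \<delta>2: "\<delta>2 > 0"
    "\<And>t. t \<in> I \<Longrightarrow> \<bar>t - s\<bar> < \<delta>2 \<Longrightarrow> l2_bounded (e/2) (\<lambda>n. y (Suc n) t - y (Suc n) s)"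
    using l2_continuous_atE[OF assms(2) half_gt_zero[OF \<open>e > 0\<close>]] by blast
  have "l2_bounded e (\<lambda>n. y n t - y n s)" if "t \<in> I" "\<bar>t - s\<bar> < min \<delta>1 \<delta>2" for t
    using l2_bounded_cons[of "\<lambda>n. y n t - y n s" "e/2" "e/2"] \<delta>1(2)[of t] \<delta>2(2)[of t] that
    by simp
  then show "\<exists>\<delta>>0. \<forall>t\<in>I. \<bar>t - s\<bar> < \<delta> \<longrightarrow> l2_bounded e (\<lambda>n. y n t - y n s)"
    using \<delta>1(1) \<delta>2(1) by (intro exI[of _ "min \<delta>1 \<delta>2"]) auto
qed

lemma l2_derivative_at_if_derivative_continuous:
  assumes I: "s \<in> {a..b}"
    and deriv: "\<And>n r. r \<in> {a..b} \<Longrightarrow> (y n has_real_derivative y' n r) (at r within {a..b})"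
    and cont: "l2_continuous_at {a..b} s y'"
  shows "l2_derivative_at {a..b} s y (\<lambda>n. y' n s)"
  unfolding l2_derivative_at_def
proof (intro allI impI)
  fix e :: real assume "e > 0"
  obtain \<delta> where "\<delta> > 0" and \<delta>: "\<And>t. t \<in> {a..b} \<Longrightarrow> \<bar>t - s\<bar> < \<delta> \<Longrightarrow>
      l2_bounded e (\<lambda>n. y' n t - y' n s)"
    using l2_continuous_atE[OF cont \<open>e > 0\<close>] by blast
  have "l2_bounded (e * \<bar>t - s\<bar>) (\<lambda>n. y n t - y n s - (t - s) * y' n s)"
    if t: "t \<in> {a..b}" "\<bar>t - s\<bar> < \<delta>" for t
  proof -
    have seg: "closed_segment s t \<subseteq> {a..b}"
      using I t(1) by (auto simp: closed_segment_eq_real_ivl)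
    have "l2_bounded (e * \<bar>t - s\<bar>) (\<lambda>n. (y n t - t * y' n s) - (y n s - s * y' n s))"
    proof (rule l2_bounded_increment)
      fix n r assume r: "r \<in> closed_segment s t"
      show "((\<lambda>r. y n r - r * y' n s) has_real_derivative (y' n r - y' n s))
          (at r within closed_segment s t)"
        using DERIV_subset[OF deriv seg, of r n] r seg
        by (auto intro!: derivative_eq_intros)
    next
      fix r assume r: "r \<in> closed_segment s t"
      then have "\<bar>r - s\<bar> < \<delta>" "r \<in> {a..b}"
        using t seg by (auto simp: closed_segment_eq_real_ivl split: if_splits)
      then show "l2_bounded e (\<lambda>n. y' n r - y' n s)" by (intro \<delta>)
    qed
    then show ?thesis by (simp add: algebra_simps)
  qed
  then show "\<exists>\<delta>>0. \<forall>t\<in>{a..b}. \<bar>t - s\<bar> < \<delta> \<longrightarrow>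
      l2_bounded (e * \<bar>t - s\<bar>) (\<lambda>n. y n t - y n s - (t - s) * y' n s)"
    using \<open>\<delta> > 0\<close> by blast
qed

lemma has_real_derivative_withinI_eps:
  fixes f :: "real \<Rightarrow> real"
  assumes "\<And>e. e > 0 \<Longrightarrow> \<exists>\<delta>>0. \<forall>t\<in>I. \<bar>t - s\<bar> < \<delta> \<longrightarrow> \<bar>f t - f s - (t - s) * D\<bar> \<le> e * \<bar>t - s\<bar>"
  shows "(f has_real_derivative D) (at s within I)"
  unfolding has_field_derivative_def has_derivative_within_alt
  using assms by (auto intro!: bounded_linear_mult_right simp: mult.commute)

lemma has_real_derivative_0_if_quadratic:
  fixes f :: "real \<Rightarrow> real"
  assumes "\<And>t. t \<in> I \<Longrightarrow> \<bar>f t\<bar> \<le> M * (t - s)\<^sup>2" "s \<in> I"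
  shows "(f has_real_derivative 0) (at s within I)"
proof (rule has_real_derivative_withinI_eps)
  fix e :: real assume "e > 0"
  have "f s = 0" using assms(1)[OF assms(2)] by simp
  have "\<bar>f t\<bar> \<le> e * \<bar>t - s\<bar>" if t: "t \<in> I" "\<bar>t - s\<bar> < e / (\<bar>M\<bar> + 1)" for t
  proof -
    have "\<bar>f t\<bar> \<le> M * \<bar>t - s\<bar> * \<bar>t - s\<bar>" using assms(1)[OF t(1)] by (simp add: power2_eq_square mult.assoc)
    also have "\<dots> \<le> ((\<bar>M\<bar> + 1) * \<bar>t - s\<bar>) * \<bar>t - s\<bar>"
      by (intro mult_right_mono) auto
    also have "\<dots> \<le> e * \<bar>t - s\<bar>"
      using t(2) by (intro mult_right_mono) (auto simp: field_simps)
    finally show ?thesis .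
  qed
  then show "\<exists>\<delta>>0. \<forall>t\<in>I. \<bar>t - s\<bar> < \<delta> \<longrightarrow> \<bar>f t - f s - (t - s) * 0\<bar> \<le> e * \<bar>t - s\<bar>"
    using \<open>e > 0\<close> \<open>f s = 0\<close> by (intro exI[of _ "e / (\<bar>M\<bar> + 1)"]) auto
qed

text \<open>The entries \<open>y n t\<close> enter through their increments only, which makes the series meaningful
  for curves that are not square-summable.\<close>

lemma l2_derivative_inner:
  assumes y: "l2_derivative_at I s y y'"
    and z: "l2_bounded Z z" and y': "l2_bounded Y y'"
    and incr: "\<And>t. t \<in> I \<Longrightarrow> l2_bounded (B t) (\<lambda>n. y n t - y n s)"
  shows "((\<lambda>t. \<Sum>n. z n * (y n t - y n s)) has_real_derivative (\<Sum>n. z n * y' n)) (at s within I)"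
proof (rule has_real_derivative_withinI_eps)
  fix e :: real assume "e > 0"
  have "Z \<ge> 0" by (rule l2_bounded_nonneg[OF z])
  define e' where "e' = e / (Z + 1)"
  have "e' > 0" and Ze: "Z * e' \<le> e" using \<open>e > 0\<close> \<open>Z \<ge> 0\<close> by (auto simp: e'_def field_simps)
  obtain \<delta> where "\<delta> > 0" and \<delta>: "\<And>t. t \<in> I \<Longrightarrow> \<bar>t - s\<bar> < \<delta> \<Longrightarrow>
      l2_bounded (e' * \<bar>t - s\<bar>) (\<lambda>n. y n t - y n s - (t - s) * y' n)"
    using l2_derivative_atE[OF y \<open>e' > 0\<close>] by blast
  have "\<bar>(\<Sum>n. z n * (y n t - y n s)) - (t - s) * (\<Sum>n. z n * y' n)\<bar> \<le> e * \<bar>t - s\<bar>"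
    if t: "t \<in> I" "\<bar>t - s\<bar> < \<delta>" for t
  proof -
    note s1 = l2_bounded_prod(1)[OF z incr[OF t(1)]] and s2 = l2_bounded_prod(1)[OF z y']
    have "(\<lambda>n. z n * (y n t - y n s) - (t - s) * (z n * y' n)) sums
        ((\<Sum>n. z n * (y n t - y n s)) - (t - s) * (\<Sum>n. z n * y' n))"
      by (intro sums_diff sums_mult summable_sums s1 s2)
    also have "(\<lambda>n. z n * (y n t - y n s) - (t - s) * (z n * y' n))
        = (\<lambda>n. z n * (y n t - y n s - (t - s) * y' n))"
      by (simp add: algebra_simps)
    finally have "(\<Sum>n. z n * (y n t - y n s)) - (t - s) * (\<Sum>n. z n * y' n)
        = (\<Sum>n. z n * (y n t - y n s - (t - s) * y' n))"
      by (simp add: sums_iff)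
    also have "\<bar>\<dots>\<bar> \<le> Z * (e' * \<bar>t - s\<bar>)"
      by (rule l2_bounded_prod(2)[OF z \<delta>[OF t]])
    also have "\<dots> \<le> e * \<bar>t - s\<bar>" using mult_right_mono[OF Ze, of "\<bar>t - s\<bar>"] by (simp add: mult.assoc)
    finally show ?thesis .
  qed
  then show "\<exists>\<delta>>0. \<forall>t\<in>I. \<bar>t - s\<bar> < \<delta> \<longrightarrow>
      \<bar>(\<Sum>n. z n * (y n t - y n s)) - (\<Sum>n. z n * (y n s - y n s)) - (t - s) * (\<Sum>n. z n * y' n)\<bar> \<le> e * \<bar>t - s\<bar>"
    using \<open>\<delta> > 0\<close> by auto
qed

text \<open>Expand \<open>|y t|\<^sup>2\<close> around \<open>y s\<close>: the cross term carries the derivative, and the square of the increment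
  is quadratic in \<open>t - s\<close>.\<close>

lemma l2_norm_square_has_derivative:
  assumes y: "l2_derivative_at I s y y'" and "s \<in> I"
    and y': "l2_bounded Y' y'" and Y: "\<And>t. t \<in> I \<Longrightarrow> l2_bounded Y (\<lambda>n. y n t)"
    and lip: "\<And>t. t \<in> I \<Longrightarrow> l2_bounded (B * \<bar>t - s\<bar>) (\<lambda>n. y n t - y n s)"
  shows "((\<lambda>t. \<Sum>n. (y n t)\<^sup>2) has_real_derivative 2 * (\<Sum>n. y n s * y' n)) (at s within I)"
proof -
  have eq: "(\<Sum>n. (y n t)\<^sup>2) = (\<Sum>n. (y n s)\<^sup>2) + 2 * (\<Sum>n. y n s * (y n t - y n s))
      + (\<Sum>n. (y n t - y n s)\<^sup>2)" if t: "t \<in> I" for t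
  proof -
    have "(\<lambda>n. (y n s)\<^sup>2 + 2 * (y n s * (y n t - y n s)) + (y n t - y n s)\<^sup>2) sums
        ((\<Sum>n. (y n s)\<^sup>2) + 2 * (\<Sum>n. y n s * (y n t - y n s)) + (\<Sum>n. (y n t - y n s)\<^sup>2))"
      by (intro sums_add sums_mult summable_sums l2_bounded_summable(1)[OF Y[OF \<open>s \<in> I\<close>]]
          l2_bounded_summable(1)[OF lip[OF t]] l2_bounded_prod(1)[OF Y[OF \<open>s \<in> I\<close>] lip[OF t]])
    also have "(\<lambda>n. (y n s)\<^sup>2 + 2 * (y n s * (y n t - y n s)) + (y n t - y n s)\<^sup>2) = (\<lambda>n. (y n t)\<^sup>2)"
      by (simp add: power2_eq_square algebra_simps)
    finally show ?thesis by (simp add: sums_iff)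
  qed
  have "\<bar>\<Sum>n. (y n t - y n s)\<^sup>2\<bar> \<le> B\<^sup>2 * (t - s)\<^sup>2" if "t \<in> I" for t
    using l2_bounded_summable[OF lip[OF that]] by (simp add: power_mult_distrib suminf_nonneg)
  then have "((\<lambda>t. \<Sum>n. (y n t - y n s)\<^sup>2) has_real_derivative 0) (at s within I)"
    using \<open>s \<in> I\<close> by (rule has_real_derivative_0_if_quadratic)
  then have "((\<lambda>t. (\<Sum>n. (y n s)\<^sup>2) + 2 * (\<Sum>n. y n s * (y n t - y n s)) + (\<Sum>n. (y n t - y n s)\<^sup>2))
      has_real_derivative 2 * (\<Sum>n. y n s * y' n)) (at s within I)"
    by (auto intro!: derivative_eq_intros l2_derivative_inner[OF y Y[OF \<open>s \<in> I\<close>] y' lip])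
  then show ?thesis
    using zero_less_one \<open>s \<in> I\<close> by (rule has_field_derivative_transform_within) (simp add: eq)
qed

section \<open>The energy balance on intervals of bounded velocity\<close>

lemma laplacian_Suc: "laplacian x (Suc n) = x (Suc (Suc n)) - 2 * x (Suc n) + x n"
  by (simp add: laplacian_def)

lemma l2_bounded_laplacian:
  assumes "l2_bounded B x" shows "l2_bounded (4 * B) (\<lambda>n. laplacian x (Suc n))"
proof -
  note b1 = l2_bounded_Suc[OF assms]
  have "l2_bounded (B + \<bar>2\<bar> * B + B) (\<lambda>n. x (Suc (Suc n)) - 2 * x (Suc n) + x n)"
    by (intro l2_bounded_add l2_bounded_diff l2_bounded_scale b1 assms l2_bounded_Suc[OF b1])
  then show ?thesis by (simp add: laplacian_Suc)
qed

text \<open>With \<open>d n = x (n + 1) - x n\<close>, the terms are \<open>x (n + 1) d (n + 1) - x n d n - (d n)\<^sup>2\<close>, and the first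
  two telescope. This is where the internal damping produces its boundary term.\<close>

lemma l2_sums_by_parts_laplacian:
  assumes "l2_bounded B x"
  shows "(\<lambda>n. x (Suc n) * laplacian x (Suc n)) sums
    (- (\<Sum>n. (x (Suc n) - x n)\<^sup>2) - (x 1 - x 0) * x 0)"
proof -
  define d where "d n = x (Suc n) - x n" for n
  note b1 = l2_bounded_Suc[OF assms]
  have d: "l2_bounded (B + B) d" unfolding d_def by (intro l2_bounded_diff b1 assms)
  have "(\<lambda>n. x n * d n) \<longlonglongrightarrow> 0 * 0"
    by (intro tendsto_mult l2_bounded_tendsto_0[OF assms] l2_bounded_tendsto_0[OF d])
  then have "(\<lambda>n. x (Suc n) * d (Suc n) - x n * d n) sums (0 - x 0 * d 0)"
    by (intro telescope_sums) simp
  then have "(\<lambda>n. (x (Suc n) * d (Suc n) - x n * d n) - (d n)\<^sup>2) sums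
      (0 - x 0 * d 0 - (\<Sum>n. (d n)\<^sup>2))"
    by (rule sums_diff[OF _ summable_sums[OF l2_bounded_summable(1)[OF d]]])
  also have "(\<lambda>n. (x (Suc n) * d (Suc n) - x n * d n) - (d n)\<^sup>2) = (\<lambda>n. x (Suc n) * laplacian x (Suc n))"
    by (simp add: laplacian_Suc d_def power2_eq_square algebra_simps)
  finally show ?thesis by (simp add: d_def algebra_simps)
qed

text \<open>If \<open>L \<noteq> 0\<close>, then \<open>|x|\<close> has to grow at least like \<open>|L| / (2 |w|)\<close>.\<close>

lemma tendsto_0_if_factor_not_at_top:
  fixes x w :: "nat \<Rightarrow> real"
  assumes "(\<lambda>n. x n * w n) \<longlonglongrightarrow> L" "w \<longlonglongrightarrow> 0"
    and "\<not> filterlim (\<lambda>n. \<bar>x n\<bar>) at_top sequentially"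
  shows "L = 0"
proof (rule ccontr)
  assume "L \<noteq> 0"
  have "filterlim (\<lambda>n. \<bar>x n\<bar>) at_top sequentially"
    unfolding filterlim_at_top
  proof
    fix Z
    have "(\<lambda>n. \<bar>x n * w n\<bar>) \<longlonglongrightarrow> \<bar>L\<bar>" by (rule tendsto_rabs[OF assms(1)])
    then have "\<forall>\<^sub>F n in sequentially. \<bar>L\<bar> / 2 < \<bar>x n * w n\<bar>"
      using \<open>L \<noteq> 0\<close> by (intro order_tendstoD) auto
    moreover have "(\<lambda>n. \<bar>Z\<bar> * \<bar>w n\<bar>) \<longlonglongrightarrow> \<bar>Z\<bar> * \<bar>0\<bar>"
      by (intro tendsto_intros assms)
    then have "\<forall>\<^sub>F n in sequentially. \<bar>Z\<bar> * \<bar>w n\<bar> < \<bar>L\<bar> / 2"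
      using \<open>L \<noteq> 0\<close> by (intro order_tendstoD) auto
    ultimately show "\<forall>\<^sub>F n in sequentially. Z \<le> \<bar>x n\<bar>"
    proof eventually_elim
      case (elim n)
      then have "\<bar>Z\<bar> * \<bar>w n\<bar> < \<bar>x n\<bar> * \<bar>w n\<bar>" by (simp add: abs_mult)
      then have "\<bar>Z\<bar> < \<bar>x n\<bar>" by (rule mult_right_less_imp_less) simp
      then show ?case by simp
    qed
  qed
  with assms(3) show False by blast
qed

lemma primitive_remainder_le:
  fixes V W :: "real \<Rightarrow> real"
  assumes "convex X" "x \<in> X" "y \<in> X" "0 \<le> K"
    and V: "\<And>z. (V has_real_derivative W z) (at z)"
    and W: "\<And>z z'. z \<in> X \<Longrightarrow> z' \<in> X \<Longrightarrow> \<bar>W z - W z'\<bar> \<le> K * \<bar>z - z'\<bar>"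
  shows "\<bar>V y - V x - W x * (y - x)\<bar> \<le> K * (y - x)\<^sup>2"
proof -
  have seg: "closed_segment x y \<subseteq> X" using assms closed_segment_subset by blast
  have "norm ((V y - W x * y) - (V x - W x * x)) \<le> (K * \<bar>y - x\<bar>) * norm (y - x)"
  proof (rule field_differentiable_bound[where S = "closed_segment x y" and f' = "\<lambda>z. W z - W x"])
    fix z assume z: "z \<in> closed_segment x y"
    show "((\<lambda>z. V z - W x * z) has_field_derivative W z - W x) (at z within closed_segment x y)"
      using DERIV_subset[OF V subset_UNIV, of z] by (auto intro!: derivative_eq_intros)
    have "\<bar>W z - W x\<bar> \<le> K * \<bar>z - x\<bar>" using z seg assms(2) by (intro W) auto
    also have "\<dots> \<le> K * \<bar>y - x\<bar>"
      using z \<open>0 \<le> K\<close> by (intro mult_left_mono) (auto simp: closed_segment_eq_real_ivl split: if_splits)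
    finally show "norm (W z - W x) \<le> K * \<bar>y - x\<bar>" by simp
  qed auto
  also have "(V y - W x * y) - (V x - W x * x) = V y - V x - W x * (y - x)" by (simp add: algebra_simps)
  finally show ?thesis by (simp add: power2_eq_square mult.assoc)
qed

text \<open>Index \<open>n\<close> of \<open>force\<close> and \<open>friction\<close> refers to the site \<open>n + 1\<close>, since the site \<open>0\<close> is driven by the
  boundary condition. The force collects the conservative terms, with \<open>W\<close> the derivative of \<open>V\<close>,
  and the friction those that are linear in the velocity.\<close>

locale oscillator_chain =
  fixes c \<beta> \<gamma> m2 :: real and V W :: "real \<Rightarrow> real" and u v :: "nat \<Rightarrow> real \<Rightarrow> real"
begin

definition force :: "nat \<Rightarrow> real \<Rightarrow> real" where
  "force n t = c\<^sup>2 * laplacian (\<lambda>k. u k t) (Suc n) - m2 * u (Suc n) t - W (u (Suc n) t)"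

definition friction :: "nat \<Rightarrow> real \<Rightarrow> real" where
  "friction n t = \<beta> * laplacian (\<lambda>k. v k t) (Suc n) - \<gamma> * v (Suc n) t"

end

text \<open>The assumption \<open>no_escape\<close> is what makes the energy flux through the far end vanish; it
  depends on the potential and on the sign of \<open>m2\<close>.\<close>

locale damped_chain = oscillator_chain +
  assumes pos: "0 < c" "0 \<le> \<beta>" "0 \<le> \<gamma>"
    and u_deriv: "\<And>n t. 0 < t \<Longrightarrow> (u n has_real_derivative v n t) (at t)"
    and v_deriv: "\<And>n t. 0 < t \<Longrightarrow>
      (v (Suc n) has_real_derivative force n t + friction n t) (at t)"
    and v0_cont: "continuous_on {0<..} (v 0)"
    and V_deriv: "\<And>x. (V has_real_derivative W x) (at x)"
    and v_l2: "\<And>t. 0 < t \<Longrightarrow> summable (\<lambda>n. (v n t)\<^sup>2)"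
    and energy_summable: "\<And>t. 0 < t \<Longrightarrow> summable (\<lambda>n. energy_density c m2 V u (Suc n) t)"
    and no_escape: "\<And>t. 0 < t \<Longrightarrow> (\<lambda>n. force n t) \<longlonglongrightarrow> 0 \<Longrightarrow>
      \<not> filterlim (\<lambda>n. \<bar>u (Suc n) t - u n t\<bar>) at_top sequentially"
begin

definition energy_rate :: "real \<Rightarrow> real" where
  "energy_rate t = c^2 * (u 0 t - u 1 t) * v 0 t - \<gamma> * (\<Sum>n. (v (Suc n) t)\<^sup>2)
    - \<beta> * ((\<Sum>n. (v (Suc n) t - v n t)\<^sup>2) + (v 1 t - v 0 t) * v 0 t)"

lemma energy_density_eq:
  assumes "0 < t"
  shows "energy_density c m2 V u n t = 1 / 2 * ((v n t)\<^sup>2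
    + c\<^sup>2 * (u (Suc n) t - u n t)\<^sup>2 + m2 * (u n t)\<^sup>2) + V (u n t)"
  unfolding energy_density_def using DERIV_imp_deriv[OF u_deriv[OF assms]] by simp

definition drag :: real where "drag = 4 * \<beta> + \<gamma>"

lemma l2_bounded_friction:
  assumes "l2_bounded B x"
  shows "l2_bounded (drag * B) (\<lambda>n. \<beta> * laplacian x (Suc n) - \<gamma> * x (Suc n))"
proof -
  have "l2_bounded (\<bar>\<beta>\<bar> * (4 * B) + \<bar>\<gamma>\<bar> * B) (\<lambda>n. \<beta> * laplacian x (Suc n) - \<gamma> * x (Suc n))"
    by (intro l2_bounded_diff l2_bounded_scale l2_bounded_laplacian l2_bounded_Suc assms)
  then show ?thesis using pos by (simp add: drag_def algebra_simps)
qed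

text \<open>The power of the friction forces is the energy rate without the work done at the driven end.\<close>

lemma friction_energy_rate:
  assumes "0 < t"
  shows "(\<Sum>n. v (Suc n) t * friction n t) = energy_rate t - c^2 * (u 0 t - u 1 t) * v 0 t"
proof -
  note b = summable_l2_bounded[OF v_l2[OF assms]]
  have "(\<lambda>n. \<beta> * (v (Suc n) t * laplacian (\<lambda>k. v k t) (Suc n)) - \<gamma> * (v (Suc n) t)\<^sup>2) sums
    (\<beta> * (- (\<Sum>n. (v (Suc n) t - v n t)\<^sup>2) - (v 1 t - v 0 t) * v 0 t)
      - \<gamma> * (\<Sum>n. (v (Suc n) t)\<^sup>2))"
    by (intro sums_diff sums_mult l2_sums_by_parts_laplacian[OF b] summable_sums
        l2_bounded_summable(1)[OF l2_bounded_Suc[OF b]])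
  also have "(\<lambda>n. \<beta> * (v (Suc n) t * laplacian (\<lambda>k. v k t) (Suc n)) - \<gamma> * (v (Suc n) t)\<^sup>2)
      = (\<lambda>n. v (Suc n) t * friction n t)"
    by (simp add: friction_def power2_eq_square algebra_simps)
  finally show ?thesis by (simp add: sums_iff energy_rate_def algebra_simps)
qed

end

text \<open>A time interval on which the velocities are bounded in \<open>l\<^sup>2\<close>. The set \<open>X\<close> confines the positions,
  so that \<open>W\<close> need only be Lipschitz there.\<close>

locale bounded_damped_chain = damped_chain +
  fixes a b S K :: real and X :: "real set"
  assumes ab: "0 < a" "a < b"
    and v_bound: "\<And>t. t \<in> {a..b} \<Longrightarrow> l2_bounded S (\<lambda>n. v n t)"
    and X: "convex X" "\<And>n t. t \<in> {a..b} \<Longrightarrow> u (Suc n) t \<in> X"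
    and W_Lipschitz: "0 \<le> K" "\<And>x y. x \<in> X \<Longrightarrow> y \<in> X \<Longrightarrow> \<bar>W x - W y\<bar> \<le> K * \<bar>x - y\<bar>"
begin

lemma segment_subset: "s \<in> {a..b} \<Longrightarrow> t \<in> {a..b} \<Longrightarrow> closed_segment s t \<subseteq> {a..b}"
  by (auto simp: closed_segment_eq_real_ivl)

lemma u_deriv_within:
  assumes "r \<in> closed_segment s t" "s \<in> {a..b}" "t \<in> {a..b}"
  shows "(u n has_real_derivative v n r) (at r within closed_segment s t)"
proof -
  have "r \<in> {a..b}" using segment_subset[OF assms(2,3)] assms(1) by blast
  then have "0 < r" using ab by simp
  then show ?thesis by (rule has_field_derivative_at_within[OF u_deriv])
qed

lemma v_deriv_within:
  assumes "r \<in> closed_segment s t" "s \<in> {a..b}" "t \<in> {a..b}"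
  shows "(v (Suc n) has_real_derivative force n r + friction n r) (at r within closed_segment s t)"
proof -
  have "r \<in> {a..b}" using segment_subset[OF assms(2,3)] assms(1) by blast
  then have "0 < r" using ab by simp
  then show ?thesis by (rule has_field_derivative_at_within[OF v_deriv])
qed

lemma S_nonneg: "0 \<le> S"
  using l2_bounded_nonneg[OF v_bound[of a]] ab by simp

lemma u_increment:
  assumes "s \<in> {a..b}" "t \<in> {a..b}"
  shows "l2_bounded (S * \<bar>t - s\<bar>) (\<lambda>n. u n t - u n s)"
  by (rule l2_bounded_increment[where y' = v])
    (use assms segment_subset[OF assms] in \<open>auto intro: u_deriv_within v_bound\<close>)

definition stiffness :: real where "stiffness = 4 * c\<^sup>2 + \<bar>m2\<bar> + K"

lemma force_increment:
  assumes "s \<in> {a..b}" "t \<in> {a..b}"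
  shows "l2_bounded (stiffness * S * \<bar>t - s\<bar>) (\<lambda>n. force n t - force n s)"
proof -
  define w where "w n = u n t - u n s" for n
  have w: "l2_bounded (S * \<bar>t - s\<bar>) w" unfolding w_def by (rule u_increment[OF assms])
  note w1 = l2_bounded_Suc[OF w]
  have "l2_bounded (K * (S * \<bar>t - s\<bar>)) (\<lambda>n. W (u (Suc n) t) - W (u (Suc n) s))"
    by (rule l2_bounded_dominated[OF w1]) (use W_Lipschitz X assms in \<open>auto simp: w_def\<close>)
  then have "l2_bounded (\<bar>c\<^sup>2\<bar> * (4 * (S * \<bar>t - s\<bar>)) + \<bar>m2\<bar> * (S * \<bar>t - s\<bar>) + K * (S * \<bar>t - s\<bar>))
      (\<lambda>n. c\<^sup>2 * laplacian w (Suc n) - m2 * w (Suc n) - (W (u (Suc n) t) - W (u (Suc n) s)))"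
    by (intro l2_bounded_diff l2_bounded_scale l2_bounded_laplacian w w1)
  then show ?thesis
    by (simp add: force_def w_def laplacian_Suc stiffness_def algebra_simps)
qed

lemma stiffness_nonneg: "0 \<le> stiffness"
  using W_Lipschitz by (simp add: stiffness_def)

lemma drag_nonneg: "0 \<le> drag"
  using pos by (simp add: drag_def)

text \<open>The force varies by \<open>O(|t - s| S)\<close> and the friction is \<open>O(S)\<close>, so \<open>v\<close> moves along the initial force
  up to an error that is small for a short interval. The estimate involves increments of the force only,
  not its size.\<close>

lemma v_secant:
  assumes "s \<in> {a..b}" "t \<in> {a..b}"
  shows "l2_bounded ((drag + stiffness * (b - a)) * S * \<bar>t - s\<bar>)
    (\<lambda>n. v (Suc n) t - v (Suc n) s - (t - s) * force n s)"
proof -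
  have "l2_bounded ((drag + stiffness * (b - a)) * S * \<bar>t - s\<bar>)
    (\<lambda>n. (v (Suc n) t - t * force n s) - (v (Suc n) s - s * force n s))"
  proof (rule l2_bounded_increment)
    fix n r assume "r \<in> closed_segment s t"
    then show "((\<lambda>r. v (Suc n) r - r * force n s) has_real_derivative
        friction n r + (force n r - force n s)) (at r within closed_segment s t)"
      using v_deriv_within[OF _ assms, of r n] by (auto intro!: derivative_eq_intros)
  next
    fix r assume "r \<in> closed_segment s t"
    then have r: "r \<in> {a..b}" using segment_subset[OF assms] by blast
    have "l2_bounded (drag * S + stiffness * S * \<bar>r - s\<bar>) (\<lambda>n. friction n r + (force n r - force n s))"
      unfolding friction_def
      by (intro l2_bounded_add l2_bounded_friction v_bound r force_increment assms)
    moreover have "stiffness * S * \<bar>r - s\<bar> \<le> stiffness * S * (b - a)"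
      using r assms(1) stiffness_nonneg S_nonneg by (intro mult_left_mono) auto
    ultimately show "l2_bounded ((drag + stiffness * (b - a)) * S) (\<lambda>n. friction n r + (force n r - force n s))"
      by (auto elim!: l2_bounded_mono simp: algebra_simps)
  qed
  then show ?thesis by (simp add: algebra_simps)
qed

text \<open>The form in which \<open>v_secant\<close> propagates velocity bounds; the bound \<open>S\<close> reappears with a factor that
  is small on short intervals.\<close>

lemma v_step:
  assumes "s \<in> {a..b}" "t \<in> {a..b}" "\<bar>v 0 t\<bar> \<le> D"
    and "l2_bounded M (\<lambda>n. v n s)" "l2_bounded F (\<lambda>n. (t - s) * force n s)"
  shows "l2_bounded (D + (M + F + (drag + stiffness * (b - a)) * S * \<bar>t - s\<bar>)) (\<lambda>n. v n t)"
proof (rule l2_bounded_cons)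
  show "\<bar>v 0 t\<bar> \<le> D" by (rule assms(3))
  have "l2_bounded (M + F + (drag + stiffness * (b - a)) * S * \<bar>t - s\<bar>)
    (\<lambda>n. v (Suc n) s + (t - s) * force n s + (v (Suc n) t - v (Suc n) s - (t - s) * force n s))"
    by (rule l2_bounded_add[OF l2_bounded_add[OF l2_bounded_Suc[OF assms(4)] assms(5)] v_secant[OF assms(1,2)]])
  then show "l2_bounded (M + F + (drag + stiffness * (b - a)) * S * \<bar>t - s\<bar>) (\<lambda>n. v (Suc n) t)"
    by simp
qed

text \<open>Read \<open>v_secant\<close> backwards: the velocities at two distinct times bound the force.\<close>

lemma force_bounded:
  obtains \<Phi> where "\<And>t. t \<in> {a..b} \<Longrightarrow> l2_bounded \<Phi> (\<lambda>n. force n t)"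
proof -
  have ends: "a \<in> {a..b}" "b \<in> {a..b}" using ab by auto
  note diff = l2_bounded_diff[OF l2_bounded_diff[OF
      l2_bounded_Suc[OF v_bound[OF ends(2)]] l2_bounded_Suc[OF v_bound[OF ends(1)]]] v_secant[OF ends]]
  from l2_bounded_scale[OF diff, of "1 / (b - a)"] ab
  obtain M' where M': "l2_bounded M' (\<lambda>n. force n a)" by auto
  have "l2_bounded (M' + stiffness * S * (b - a)) (\<lambda>n. force n t)" if t: "t \<in> {a..b}" for t
  proof -
    have "l2_bounded (M' + stiffness * S * \<bar>t - a\<bar>) (\<lambda>n. force n a + (force n t - force n a))"
      by (intro l2_bounded_add M' force_increment ends t)
    moreover have "stiffness * S * \<bar>t - a\<bar> \<le> stiffness * S * (b - a)"
      using t stiffness_nonneg S_nonneg by (intro mult_left_mono) auto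
    ultimately show ?thesis by (auto elim!: l2_bounded_mono)
  qed
  then show thesis by (rule that)
qed

lemma flux_tendsto_0:
  assumes "s \<in> {a..b}" "t \<in> {a..b}"
    and "(\<lambda>n. (u (Suc n) s - u n s) * (u (Suc n) t - u (Suc n) s)) \<longlonglongrightarrow> L"
  shows "L = 0"
proof (rule tendsto_0_if_factor_not_at_top[OF assms(3)])
  show "(\<lambda>n. u (Suc n) t - u (Suc n) s) \<longlonglongrightarrow> 0"
    by (rule l2_bounded_tendsto_0[OF l2_bounded_Suc[OF u_increment[OF assms(1,2)]]])
  obtain \<Phi> where "\<And>t. t \<in> {a..b} \<Longrightarrow> l2_bounded \<Phi> (\<lambda>n. force n t)" using force_bounded by blast
  then have "(\<lambda>n. force n s) \<longlonglongrightarrow> 0" using assms(1) l2_bounded_tendsto_0 by blast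
  then show "\<not> filterlim (\<lambda>n. \<bar>u (Suc n) s - u n s\<bar>) at_top sequentially"
    using no_escape assms(1) ab by auto
qed

text \<open>The part of the increment of the energy density at site \<open>n + 1\<close> that is of second order in the
  displacement \<open>u t - u s\<close>.\<close>

definition remainder :: "real \<Rightarrow> nat \<Rightarrow> real \<Rightarrow> real" where
  "remainder s n t =
    c\<^sup>2 / 2 * ((u (Suc (Suc n)) t - u (Suc (Suc n)) s) - (u (Suc n) t - u (Suc n) s))\<^sup>2
    + m2 / 2 * (u (Suc n) t - u (Suc n) s)\<^sup>2
    + (V (u (Suc n) t) - V (u (Suc n) s) - W (u (Suc n) s) * (u (Suc n) t - u (Suc n) s))"

text \<open>Summation by parts turns the increments of the elastic energy into work of the elastic forces
  and one flux term at each end of the block of sites.\<close>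

lemma partial_energy_increment:
  assumes "s \<in> {a..b}" "t \<in> {a..b}"
  shows "(\<Sum>n<N. energy_density c m2 V u (Suc n) t - energy_density c m2 V u (Suc n) s) =
    (\<Sum>n<N. ((v (Suc n) t)\<^sup>2 - (v (Suc n) s)\<^sup>2) / 2
        - force n s * (u (Suc n) t - u (Suc n) s) + remainder s n t)
    + c\<^sup>2 * ((u (Suc N) s - u N s) * (u (Suc N) t - u (Suc N) s))
    - c\<^sup>2 * ((u 1 s - u 0 s) * (u 1 t - u 1 s))"
proof (induction N)
  case (Suc N)
  have st: "0 < s" "0 < t" using assms ab by auto
  show ?case
    unfolding sum.lessThan_Suc Suc
    by (simp add: energy_density_eq[OF st(1)] energy_density_eq[OF st(2)] force_def remainder_def
        laplacian_Suc power2_eq_square field_simps)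
qed simp

lemma remainder_bound:
  assumes "s \<in> {a..b}" "t \<in> {a..b}"
  shows "summable (\<lambda>n. remainder s n t)"
    and "\<bar>\<Sum>n. remainder s n t\<bar> \<le> ((2 * c\<^sup>2 + \<bar>m2\<bar> / 2 + K) * S\<^sup>2) * (t - s)\<^sup>2"
proof -
  define w where "w n = u n t - u n s" for n
  have w: "l2_bounded (S * \<bar>t - s\<bar>) w" unfolding w_def by (rule u_increment[OF assms])
  note w1 = l2_bounded_Suc[OF w] and w2 = l2_bounded_Suc[OF l2_bounded_Suc[OF w]]
  define g where "g n = c\<^sup>2 * (w (Suc (Suc n)))\<^sup>2 + (c\<^sup>2 + \<bar>m2\<bar> / 2 + K) * (w (Suc n))\<^sup>2" for n
  have g: "g sums (c\<^sup>2 * (\<Sum>n. (w (Suc (Suc n)))\<^sup>2) + (c\<^sup>2 + \<bar>m2\<bar> / 2 + K) * (\<Sum>n. (w (Suc n))\<^sup>2))"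
    unfolding g_def[abs_def]
    by (intro sums_add sums_mult summable_sums l2_bounded_summable(1)[OF w1] l2_bounded_summable(1)[OF w2])
  have le: "\<bar>remainder s n t\<bar> \<le> g n" for n
  proof -
    have "(w (Suc (Suc n)) - w (Suc n))\<^sup>2 \<le> 2 * ((w (Suc (Suc n)))\<^sup>2 + (w (Suc n))\<^sup>2)"
      using zero_le_power2[of "w (Suc (Suc n)) + w (Suc n)"] by (simp add: power2_eq_square algebra_simps)
    then have 1: "\<bar>c\<^sup>2 / 2 * (w (Suc (Suc n)) - w (Suc n))\<^sup>2\<bar> \<le> c\<^sup>2 * (w (Suc (Suc n)))\<^sup>2 + c\<^sup>2 * (w (Suc n))\<^sup>2"
      using mult_left_mono[of _ _ "c\<^sup>2 / 2"] by (fastforce simp: abs_mult algebra_simps)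
    have 2: "\<bar>m2 / 2 * (w (Suc n))\<^sup>2\<bar> \<le> \<bar>m2\<bar> / 2 * (w (Suc n))\<^sup>2"
      by (simp add: abs_mult)
    have 3: "\<bar>V (u (Suc n) t) - V (u (Suc n) s) - W (u (Suc n) s) * w (Suc n)\<bar> \<le> K * (w (Suc n))\<^sup>2"
      unfolding w_def
      by (rule primitive_remainder_le[OF X(1)]) (use X(2) assms W_Lipschitz V_deriv in auto)
    have "\<bar>remainder s n t\<bar> \<le> (c\<^sup>2 * (w (Suc (Suc n)))\<^sup>2 + c\<^sup>2 * (w (Suc n))\<^sup>2)
        + \<bar>m2\<bar> / 2 * (w (Suc n))\<^sup>2 + K * (w (Suc n))\<^sup>2"
      unfolding remainder_def w_def[symmetric]
      by (intro order_trans[OF abs_triangle_ineq] add_mono 1 2 3)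
    then show ?thesis by (simp add: g_def algebra_simps)
  qed
  have s: "summable (\<lambda>n. \<bar>remainder s n t\<bar>)"
    by (rule summable_comparison_test'[OF sums_summable[OF g], of 0]) (use le in simp)
  then show "summable (\<lambda>n. remainder s n t)" by (rule summable_rabs_cancel)
  have "\<bar>\<Sum>n. remainder s n t\<bar> \<le> (\<Sum>n. \<bar>remainder s n t\<bar>)" by (rule summable_rabs[OF s])
  also have "\<dots> \<le> suminf g" by (intro suminf_le le s sums_summable[OF g])
  also have "\<dots> \<le> c\<^sup>2 * (S * \<bar>t - s\<bar>)\<^sup>2 + (c\<^sup>2 + \<bar>m2\<bar> / 2 + K) * (S * \<bar>t - s\<bar>)\<^sup>2"
    unfolding sums_unique[OF g, symmetric]
    using W_Lipschitz(1)
    by (intro add_mono mult_left_mono l2_bounded_summable(2)[OF w1] l2_bounded_summable(2)[OF w2]) auto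
  also have "\<dots> = ((2 * c\<^sup>2 + \<bar>m2\<bar> / 2 + K) * S\<^sup>2) * (t - s)\<^sup>2"
    by (simp add: power_mult_distrib algebra_simps)
  finally show "\<bar>\<Sum>n. remainder s n t\<bar> \<le> ((2 * c\<^sup>2 + \<bar>m2\<bar> / 2 + K) * S\<^sup>2) * (t - s)\<^sup>2" .
qed

text \<open>Every series in \<open>partial_energy_increment\<close> converges, hence so does the flux at the far end, whose
  limit is zero by \<open>flux_tendsto_0\<close>. The flux at the driven end combines with the bond energy
  between the sites \<open>0\<close> and \<open>1\<close>.\<close>

lemma energy_increment:
  assumes "s \<in> {a..b}" "t \<in> {a..b}"
  shows "total_energy c m2 V u t = total_energy c m2 V u s
    + ((\<Sum>n. (v (Suc n) t)\<^sup>2) - (\<Sum>n. (v (Suc n) s)\<^sup>2)) / 2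
    - (\<Sum>n. force n s * (u (Suc n) t - u (Suc n) s)) + (\<Sum>n. remainder s n t)
    + c\<^sup>2 * (u 0 s - u 1 s) * (u 0 t - u 0 s)
    + c\<^sup>2 / 2 * ((u 1 t - u 1 s) - (u 0 t - u 0 s))\<^sup>2"
proof -
  have st: "0 < s" "0 < t" using assms ab by auto
  obtain \<Phi> where \<Phi>: "\<And>t. t \<in> {a..b} \<Longrightarrow> l2_bounded \<Phi> (\<lambda>n. force n t)"
    using force_bounded by blast
  let ?T = "\<lambda>n. ((v (Suc n) t)\<^sup>2 - (v (Suc n) s)\<^sup>2) / 2
        - force n s * (u (Suc n) t - u (Suc n) s) + remainder s n t"
  let ?T_sum = "((\<Sum>n. (v (Suc n) t)\<^sup>2) - (\<Sum>n. (v (Suc n) s)\<^sup>2)) / 2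
    - (\<Sum>n. force n s * (u (Suc n) t - u (Suc n) s)) + (\<Sum>n. remainder s n t)"
  let ?E = "\<lambda>t n. energy_density c m2 V u (Suc n) t"
  let ?flux = "\<lambda>N. (u (Suc N) s - u N s) * (u (Suc N) t - u (Suc N) s)"
  have T: "?T sums ?T_sum"
    by (rule sums_add[OF sums_diff[OF sums_divide[OF sums_diff]]]; rule summable_sums)
      (rule remainder_bound(1)[OF assms] l2_bounded_prod(1)[OF \<Phi>[OF assms(1)] l2_bounded_Suc[OF u_increment[OF assms]]]
        l2_bounded_summable(1)[OF l2_bounded_Suc[OF v_bound[OF assms(1)]]]
        l2_bounded_summable(1)[OF l2_bounded_Suc[OF v_bound[OF assms(2)]]])+
  have E: "(\<lambda>n. ?E t n - ?E s n) sums (suminf (?E t) - suminf (?E s))"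
    by (rule sums_diff[OF summable_sums[OF energy_summable[OF st(2)]] summable_sums[OF energy_summable[OF st(1)]]])
  have "(\<lambda>N. ((\<Sum>n<N. ?E t n - ?E s n) - (\<Sum>n<N. ?T n)
      + c\<^sup>2 * ((u 1 s - u 0 s) * (u 1 t - u 1 s))) / c\<^sup>2)
      \<longlonglongrightarrow> ((suminf (?E t) - suminf (?E s)) - ?T_sum + c\<^sup>2 * ((u 1 s - u 0 s) * (u 1 t - u 1 s))) / c\<^sup>2"
    using E T pos(1) by (intro tendsto_intros) (auto simp: sums_def)
  moreover have "((\<Sum>n<N. ?E t n - ?E s n) - (\<Sum>n<N. ?T n)
      + c\<^sup>2 * ((u 1 s - u 0 s) * (u 1 t - u 1 s))) / c\<^sup>2 = ?flux N" for N
    unfolding partial_energy_increment[OF assms] using pos(1) by simp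
  ultimately have "?flux \<longlonglongrightarrow>
      ((suminf (?E t) - suminf (?E s)) - ?T_sum + c\<^sup>2 * ((u 1 s - u 0 s) * (u 1 t - u 1 s))) / c\<^sup>2"
    by simp
  from flux_tendsto_0[OF assms this]
  have "suminf (?E t) - suminf (?E s) = ?T_sum - c\<^sup>2 * ((u 1 s - u 0 s) * (u 1 t - u 1 s))"
    using pos(1) by simp
  moreover have "c\<^sup>2 / 2 * (u 1 t - u 0 t)\<^sup>2 = c\<^sup>2 / 2 * (u 1 s - u 0 s)\<^sup>2
      + c\<^sup>2 * ((u 1 s - u 0 s) * (u 1 t - u 1 s)) + c\<^sup>2 * (u 0 s - u 1 s) * (u 0 t - u 0 s)
      + c\<^sup>2 / 2 * ((u 1 t - u 1 s) - (u 0 t - u 0 s))\<^sup>2"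
    by (simp add: power2_eq_square field_simps)
  ultimately show ?thesis unfolding total_energy_def by linarith
qed

lemma v_increment:
  obtains B where "\<And>s t. s \<in> {a..b} \<Longrightarrow> t \<in> {a..b} \<Longrightarrow>
    l2_bounded (B * \<bar>t - s\<bar>) (\<lambda>n. v (Suc n) t - v (Suc n) s)"
    "\<And>t. t \<in> {a..b} \<Longrightarrow> l2_bounded B (\<lambda>n. force n t + friction n t)"
proof -
  obtain \<Phi> where \<Phi>: "\<And>t. t \<in> {a..b} \<Longrightarrow> l2_bounded \<Phi> (\<lambda>n. force n t)"
    using force_bounded by blast
  have acc: "l2_bounded (\<Phi> + drag * S) (\<lambda>n. force n t + friction n t)" if "t \<in> {a..b}" for t
    unfolding friction_def using that by (intro l2_bounded_add \<Phi> l2_bounded_friction v_bound)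
  have "l2_bounded ((\<Phi> + drag * S) * \<bar>t - s\<bar>) (\<lambda>n. v (Suc n) t - v (Suc n) s)"
    if "s \<in> {a..b}" "t \<in> {a..b}" for s t
    by (rule l2_bounded_increment[OF v_deriv_within])
      (use that segment_subset[OF that] in \<open>auto intro: acc\<close>)
  from that[OF this acc] show thesis .
qed

lemma v_continuous:
  assumes "s \<in> {a..b}" shows "l2_continuous_at {a..b} s v"
proof (rule l2_continuous_at_cons)
  have "continuous_on {a..b} (v 0)" using ab by (intro continuous_on_subset[OF v0_cont]) auto
  then show "continuous (at s within {a..b}) (v 0)"
    using assms by (simp add: continuous_on_eq_continuous_within)
  obtain B where "\<And>s t. s \<in> {a..b} \<Longrightarrow> t \<in> {a..b} \<Longrightarrow>
    l2_bounded (B * \<bar>t - s\<bar>) (\<lambda>n. v (Suc n) t - v (Suc n) s)"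
    by (rule v_increment) blast
  then show "l2_continuous_at {a..b} s (\<lambda>n. v (Suc n))"
    using assms by (intro l2_continuous_at_Lipschitz)
qed

lemma friction_continuous:
  assumes "s \<in> {a..b}" shows "l2_continuous_at {a..b} s friction"
  unfolding l2_continuous_at_def
proof (intro allI impI)
  fix e :: real assume "e > 0"
  then have "e / (drag + 1) > 0" using drag_nonneg by simp
  then obtain \<delta> where "\<delta> > 0" and \<delta>: "\<And>t. t \<in> {a..b} \<Longrightarrow> \<bar>t - s\<bar> < \<delta> \<Longrightarrow>
      l2_bounded (e / (drag + 1)) (\<lambda>n. v n t - v n s)"
    using l2_continuous_atE[OF v_continuous[OF assms]] by blast
  have "l2_bounded e (\<lambda>n. friction n t - friction n s)" if "t \<in> {a..b}" "\<bar>t - s\<bar> < \<delta>" for t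
  proof -
    have "l2_bounded (drag * (e / (drag + 1))) (\<lambda>n. friction n t - friction n s)"
      using l2_bounded_friction[OF \<delta>[OF that]]
      by (simp add: friction_def laplacian_Suc algebra_simps)
    moreover have "drag * (e / (drag + 1)) \<le> e"
      using drag_nonneg \<open>e > 0\<close> by (simp add: field_simps)
    ultimately show ?thesis by (rule l2_bounded_mono)
  qed
  then show "\<exists>\<delta>>0. \<forall>t\<in>{a..b}. \<bar>t - s\<bar> < \<delta> \<longrightarrow> l2_bounded e (\<lambda>n. friction n t - friction n s)"
    using \<open>\<delta> > 0\<close> by blast
qed

text \<open>The work of the force in the derivative of the kinetic energy cancels against that in the
  potential energy, and the friction remains.\<close>

theorem energy_derivative:
  assumes s: "s \<in> {a..b}"
  shows "(total_energy c m2 V u has_real_derivative energy_rate s) (at s within {a..b})"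
proof -
  have "0 < s" using s ab by simp
  obtain \<Phi> where \<Phi>: "\<And>t. t \<in> {a..b} \<Longrightarrow> l2_bounded \<Phi> (\<lambda>n. force n t)"
    using force_bounded by blast
  obtain B where B: "\<And>s t. s \<in> {a..b} \<Longrightarrow> t \<in> {a..b} \<Longrightarrow>
      l2_bounded (B * \<bar>t - s\<bar>) (\<lambda>n. v (Suc n) t - v (Suc n) s)"
    "\<And>t. t \<in> {a..b} \<Longrightarrow> l2_bounded B (\<lambda>n. force n t + friction n t)"
    by (rule v_increment) blast
  have u': "(u n has_real_derivative v n r) (at r within {a..b})" if "r \<in> {a..b}" for n r
    by (rule has_field_derivative_at_within[OF u_deriv]) (use that ab in simp)
  have du: "l2_derivative_at {a..b} s (\<lambda>n. u (Suc n)) (\<lambda>n. v (Suc n) s)"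
    by (rule l2_derivative_at_if_derivative_continuous[OF s u' l2_continuous_at_Lipschitz[OF B(1)[OF s]]])
  have v': "(v (Suc n) has_real_derivative force n r + friction n r) (at r within {a..b})"
    if "r \<in> {a..b}" for n r
    by (rule has_field_derivative_at_within[OF v_deriv]) (use that ab in simp)
  have dv: "l2_derivative_at {a..b} s (\<lambda>n. v (Suc n)) (\<lambda>n. force n s + friction n s)"
    by (rule l2_derivative_at_if_derivative_continuous[OF s v'
        l2_continuous_at_add[OF l2_continuous_at_Lipschitz[OF force_increment[OF s]] friction_continuous[OF s]]])
  note vs = l2_bounded_Suc[OF v_bound[OF s]]
  have P: "((\<lambda>t. \<Sum>n. (v (Suc n) t)\<^sup>2) has_real_derivative
      2 * (\<Sum>n. v (Suc n) s * (force n s + friction n s))) (at s within {a..b})"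
    by (rule l2_norm_square_has_derivative[OF dv s B(2)[OF s] l2_bounded_Suc[OF v_bound] B(1)[OF s]])
  have Q: "((\<lambda>t. \<Sum>n. force n s * (u (Suc n) t - u (Suc n) s)) has_real_derivative
      (\<Sum>n. force n s * v (Suc n) s)) (at s within {a..b})"
    by (rule l2_derivative_inner[OF du \<Phi>[OF s] vs l2_bounded_Suc[OF u_increment[OF s]]])
  have R: "((\<lambda>t. \<Sum>n. remainder s n t) has_real_derivative 0) (at s within {a..b})"
    by (rule has_real_derivative_0_if_quadratic[OF remainder_bound(2)[OF s] s])
  have "(\<Sum>n. v (Suc n) s * (force n s + friction n s))
      = (\<Sum>n. force n s * v (Suc n) s) + (\<Sum>n. v (Suc n) s * friction n s)"
  proof -
    have "l2_bounded (drag * S) (\<lambda>n. friction n s)"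
      unfolding friction_def by (rule l2_bounded_friction[OF v_bound[OF s]])
    from l2_bounded_prod(1)[OF vs this] l2_bounded_prod(1)[OF vs \<Phi>[OF s]]
    show ?thesis by (simp add: suminf_add distrib_left mult.commute)
  qed
  then have D: "2 * (\<Sum>n. v (Suc n) s * (force n s + friction n s)) / 2
      - (\<Sum>n. force n s * v (Suc n) s) + c\<^sup>2 * (u 0 s - u 1 s) * v 0 s = energy_rate s"
    using friction_energy_rate[OF \<open>0 < s\<close>] by (simp add: field_simps)
  have combine: "((\<lambda>t. C + (p t - p s) / 2 - q t + r t + k * (x t - x s)
      + l * ((y t - y s) - (x t - x s))\<^sup>2) has_real_derivative p' / 2 - q' + k * x') (at s within {a..b})"
    if "(p has_real_derivative p') (at s within {a..b})" "(q has_real_derivative q') (at s within {a..b})"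
      "(r has_real_derivative 0) (at s within {a..b})" "(x has_real_derivative x') (at s within {a..b})"
      "(y has_real_derivative y') (at s within {a..b})"
    for p q r x y :: "real \<Rightarrow> real" and p' q' x' y' C k l
    using that by (auto intro!: derivative_eq_intros)
  from combine[OF P Q R u'[OF s, of 0] u'[OF s, of 1], where C = "total_energy c m2 V u s"
      and k = "c\<^sup>2 * (u 0 s - u 1 s)" and l = "c\<^sup>2 / 2"]
  have "((\<lambda>t. total_energy c m2 V u s
    + ((\<Sum>n. (v (Suc n) t)\<^sup>2) - (\<Sum>n. (v (Suc n) s)\<^sup>2)) / 2
    - (\<Sum>n. force n s * (u (Suc n) t - u (Suc n) s)) + (\<Sum>n. remainder s n t)
    + c\<^sup>2 * (u 0 s - u 1 s) * (u 0 t - u 0 s)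
    + c\<^sup>2 / 2 * ((u 1 t - u 1 s) - (u 0 t - u 0 s))\<^sup>2) has_real_derivative energy_rate s)
    (at s within {a..b})"
    unfolding D .
  then show ?thesis
    using zero_less_one s by (rule has_field_derivative_transform_within) (simp add: energy_increment[OF s])
qed

end

section \<open>Velocity bounds for globally Lipschitz forces\<close>

context damped_chain
begin

lemma boundary_velocity_bound:
  assumes "0 < p"
  obtains D where "0 \<le> D" "\<And>t. t \<in> {p..q} \<Longrightarrow> \<bar>v 0 t\<bar> \<le> D"
proof -
  have "continuous_on {p..q} (v 0)" using assms by (intro continuous_on_subset[OF v0_cont]) auto
  then have "bounded (v 0 ` {p..q})"
    by (intro compact_imp_bounded compact_continuous_image) auto
  then obtain D where "0 < D" "\<And>t. t \<in> {p..q} \<Longrightarrow> \<bar>v 0 t\<bar> \<le> D"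
    by (auto simp: bounded_pos)
  then show thesis by (intro that[of D]) auto
qed

lemma v_continuous_on: "0 < p \<Longrightarrow> continuous_on {p..q} (v n)"
proof (cases n)
  case 0
  assume "0 < p"
  then show ?thesis unfolding 0 by (intro continuous_on_subset[OF v0_cont]) auto
next
  case (Suc k)
  assume "0 < p"
  then show ?thesis unfolding Suc
    by (intro DERIV_atLeastAtMost_imp_continuous_on) (meson order_less_le_trans v_deriv)
qed

lemma u_continuous_on: "0 < p \<Longrightarrow> continuous_on {p..q} (u n)"
  by (intro DERIV_atLeastAtMost_imp_continuous_on) (meson order_less_le_trans u_deriv)

text \<open>Inside a gap, \<open>v_step\<close> from one time \<open>s\<close> gives a bound in terms of the velocity and the force at
  \<open>s\<close>. The force at an end point of a gap is not controlled by the velocity there, but two end points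
  \<open>a\<close> and \<open>b\<close> control \<open>(b - a) f a\<close>, which is all that \<open>v_step\<close> needs.\<close>

lemma bounded_if_Lipschitz:
  assumes W: "0 \<le> K" "\<And>x y. \<bar>W x - W y\<bar> \<le> K * \<bar>x - y\<bar>" and p: "0 < p" "p < q"
  shows "\<exists>S. bounded_damped_chain c \<beta> \<gamma> m2 V W u v p q S K UNIV"
proof -
  have chain: "bounded_damped_chain c \<beta> \<gamma> m2 V W u v a b S K UNIV"
    if "p \<le> a" "a < b" "\<forall>t\<in>{a..b}. \<forall>N. L2_set (\<lambda>n. v n t) {..<N} \<le> S" for a b S
    using that W p(1)
    by unfold_locales (auto simp: l2_bounded_def)
  obtain D where D: "0 \<le> D" "\<And>t. t \<in> {p..q} \<Longrightarrow> \<bar>v 0 t\<bar> \<le> D"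
    using boundary_velocity_bound[OF p(1)] by blast
  define C where "C = drag + (4 * c\<^sup>2 + \<bar>m2\<bar> + K)"
  have "0 \<le> drag" using pos by (simp add: drag_def)
  then have "0 \<le> C" using W(1) by (simp add: C_def)
  define h where "h = 1 / (4 * C + 1)"
  have h: "0 < h" "h \<le> 1" "C * h \<le> 1 / 4" using \<open>0 \<le> C\<close> by (auto simp: h_def field_simps)
  have small: "(drag + (4 * c\<^sup>2 + \<bar>m2\<bar> + K) * l) * S * x \<le> S / 4"
    if "l \<le> 1" "0 \<le> x" "x \<le> h" "0 \<le> S" for l S x
  proof -
    have "drag + (4 * c\<^sup>2 + \<bar>m2\<bar> + K) * l \<le> C"
      unfolding C_def using that(1) W(1) by (simp add: mult_left_le)
    then have "(drag + (4 * c\<^sup>2 + \<bar>m2\<bar> + K) * l) * x \<le> C * x"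
      using that(2) by (rule mult_right_mono)
    also have "\<dots> \<le> C * h" using that(3) \<open>0 \<le> C\<close> by (rule mult_left_mono)
    also have "\<dots> \<le> 1 / 4" by (rule h(3))
    finally have "((drag + (4 * c\<^sup>2 + \<bar>m2\<bar> + K) * l) * x) * S \<le> 1 / 4 * S"
      using that(4) by (rule mult_right_mono)
    then show ?thesis by (simp add: mult_ac)
  qed
  have improve: "\<forall>t\<in>{a..b}. \<forall>N. L2_set (\<lambda>n. v n t) {..<N} \<le> 2 * A"
    if win: "p \<le> a" "a < b" "b \<le> q" "b - a < h" and k: "\<forall>t\<in>{a..b}. \<forall>N. L2_set (\<lambda>n. v n t) {..<N} \<le> k"
      and s: "s \<in> {a..b}" and M: "l2_bounded M (\<lambda>n. v n s)" and A: "0 \<le> F" "A = D + M + F"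
      and F: "\<And>S t. 0 \<le> S \<Longrightarrow> t \<in> {a..b} \<Longrightarrow> (\<And>t. t \<in> {a..b} \<Longrightarrow> l2_bounded S (\<lambda>n. v n t)) \<Longrightarrow>
        l2_bounded (F + S / 4) (\<lambda>n. (t - s) * force n s)"
    for a b k s M F A
  proof -
    have "L2_set (\<lambda>n. v n (fst i)) {..<snd i} \<le> 2 * A" if "i \<in> {a..b} \<times> UNIV" for i
    proof (rule bound_by_absorption[where g = "\<lambda>i. L2_set (\<lambda>n. v n (fst i)) {..<snd i}"])
      show "L2_set (\<lambda>n. v n (fst i)) {..<snd i} \<le> k" if "i \<in> {a..b} \<times> UNIV" for i
        using k that by auto
      show "0 \<le> A" using D(1) A l2_bounded_nonneg[OF M] by simp
      fix S :: real and i :: "real \<times> nat"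
      assume S: "0 \<le> S" "\<And>i. i \<in> {a..b} \<times> UNIV \<Longrightarrow> L2_set (\<lambda>n. v n (fst i)) {..<snd i} \<le> S"
        and i: "i \<in> {a..b} \<times> UNIV"
      have S': "L2_set (\<lambda>n. v n t) {..<N} \<le> S" if "t \<in> {a..b}" for t N
        using S(2)[of "(t, N)"] that by simp
      then interpret bounded_damped_chain c \<beta> \<gamma> m2 V W u v a b S K UNIV
        using win by (intro chain) auto
      define t where "t = fst i"
      have t: "t \<in> {a..b}" "t \<in> {p..q}" using i win by (auto simp: t_def)
      have "l2_bounded (D + (M + (F + S / 4) + (drag + stiffness * (b - a)) * S * \<bar>t - s\<bar>)) (\<lambda>n. v n t)"
        using S' by (intro v_step s t D(2) M F S(1)) (auto simp: l2_bounded_def)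
      moreover have "(drag + stiffness * (b - a)) * S * \<bar>t - s\<bar> \<le> S / 4"
        unfolding stiffness_def using t(1) s win h(2) S(1) by (intro small) auto
      ultimately have "l2_bounded (A + S / 2) (\<lambda>n. v n t)"
        by (elim l2_bounded_mono) (simp add: A)
      then show "L2_set (\<lambda>n. v n (fst i)) {..<snd i} \<le> A + S / 2"
        by (simp add: t_def l2_bounded_def)
    qed (use that in auto)
    then show ?thesis by auto
  qed
  have "\<exists>k. \<forall>t\<in>{p..q}. \<forall>N. L2_set (\<lambda>n. v n t) {..<N} \<le> k"
  proof (rule bounded_by_propagation[OF h(1)])
    show "continuous_on {p..q} (\<lambda>t. L2_set (\<lambda>n. v n t) {..<N})" for N
      unfolding L2_set_def by (intro continuous_intros v_continuous_on p)
    show "\<exists>k. \<forall>N. L2_set (\<lambda>n. v n t) {..<N} \<le> k" if "t \<in> {p..q}" for t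
      using summable_l2_bounded[OF v_l2[of t]] that p by (auto simp: l2_bounded_def)
  next
    fix s assume s: "s \<in> {p..q}"
    obtain M where M: "l2_bounded M (\<lambda>n. v n s)"
      using summable_l2_bounded[OF v_l2[of s]] s p by auto
    show "\<exists>C. \<forall>a b k. p \<le> a \<and> a < b \<and> b \<le> q \<and> b - a < h \<and> s \<in> {a..b}
        \<and> (\<forall>t\<in>{a..b}. \<forall>N. L2_set (\<lambda>n. v n t) {..<N} \<le> k)
        \<longrightarrow> (\<forall>t\<in>{a..b}. \<forall>N. L2_set (\<lambda>n. v n t) {..<N} \<le> C)"
    \<comment> \<open>If the force at \<open>s\<close> is not square-summable, then no interval around \<open>s\<close> has bounded velocities,
      and the claim is vacuous.\<close>
    proof (cases "\<exists>F. l2_bounded F (\<lambda>n. force n s)")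
      case True
      then obtain F where F: "l2_bounded F (\<lambda>n. force n s)" by blast
      have "l2_bounded (F + S / 4) (\<lambda>n. (t - s) * force n s)"
        if "0 \<le> S" "b - a < h" "s \<in> {a..b}" "t \<in> {a..b}" for S a b t
      proof -
        have "\<bar>t - s\<bar> \<le> 1" using that h(2) by auto
        then have "l2_bounded (1 * F) (\<lambda>n. (t - s) * force n s)"
          by (intro l2_bounded_dominated[OF F]) (auto simp: abs_mult intro: mult_left_le_one_le)
        then show ?thesis using that(1) by (elim l2_bounded_mono) auto
      qed
      then show ?thesis
        using improve[OF _ _ _ _ _ _ M l2_bounded_nonneg[OF F] refl] by (intro exI[of _ "2 * (D + M + F)"]) blast
    next
      case False
      have "\<not> (\<forall>t\<in>{a..b}. \<forall>N. L2_set (\<lambda>n. v n t) {..<N} \<le> k)"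
        if "p \<le> a" "a < b" "s \<in> {a..b}" for a b k
      proof
        assume "\<forall>t\<in>{a..b}. \<forall>N. L2_set (\<lambda>n. v n t) {..<N} \<le> k"
        then interpret bounded_damped_chain c \<beta> \<gamma> m2 V W u v a b k K UNIV
          using that by (intro chain) auto
        show False using force_bounded False that(3) by metis
      qed
      then show ?thesis by blast
    qed
  next
    fix M :: real
    have "\<forall>t\<in>{a..b}. \<forall>N. L2_set (\<lambda>n. v n t) {..<N} \<le> 2 * (D + M + 2 * M)"
      if win: "p \<le> a" "a < b" "b \<le> q" "b - a < h" and
        M: "\<forall>N. L2_set (\<lambda>n. v n a) {..<N} \<le> M" "\<forall>N. L2_set (\<lambda>n. v n b) {..<N} \<le> M" and
        k: "\<forall>t\<in>{a..b}. \<forall>N. L2_set (\<lambda>n. v n t) {..<N} \<le> k" for a b k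
    proof (rule improve[OF win k])
      show Ma: "l2_bounded M (\<lambda>n. v n a)" using M(1) by (simp add: l2_bounded_def)
      show "0 \<le> 2 * M" using l2_bounded_nonneg[OF Ma] by simp
      fix S t assume S: "0 \<le> S" "\<And>t. t \<in> {a..b} \<Longrightarrow> l2_bounded S (\<lambda>n. v n t)" and t: "t \<in> {a..b}"
      then interpret bounded_damped_chain c \<beta> \<gamma> m2 V W u v a b S K UNIV
        using win by (intro chain) (auto simp: l2_bounded_def)
      have ends: "a \<in> {a..b}" "b \<in> {a..b}" using win by auto
      have Mb: "l2_bounded M (\<lambda>n. v n b)" using M(2) by (simp add: l2_bounded_def)
      have "l2_bounded (M + M + (drag + stiffness * (b - a)) * S * \<bar>b - a\<bar>) (\<lambda>n. (b - a) * force n a)"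
        using l2_bounded_diff[OF l2_bounded_diff[OF l2_bounded_Suc[OF Mb] l2_bounded_Suc[OF Ma]] v_secant[OF ends]]
        by simp
      moreover have "(drag + stiffness * (b - a)) * S * \<bar>b - a\<bar> \<le> S / 4"
        unfolding stiffness_def using win h(2) S(1) by (intro small) auto
      ultimately have "l2_bounded (2 * M + S / 4) (\<lambda>n. (b - a) * force n a)"
        by (elim l2_bounded_mono) simp
      then have "l2_bounded (1 * (2 * M + S / 4)) (\<lambda>n. (t - a) * force n a)"
        by (rule l2_bounded_dominated) (use t in \<open>auto simp: abs_mult intro: mult_right_mono\<close>)
      then show "l2_bounded (2 * M + S / 4) (\<lambda>n. (t - a) * force n a)" by simp
    qed (use win in auto)
    then show "\<exists>C. \<forall>a b k. p \<le> a \<and> a < b \<and> b \<le> q \<and> b - a < h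
        \<and> (\<forall>N. L2_set (\<lambda>n. v n a) {..<N} \<le> M) \<and> (\<forall>N. L2_set (\<lambda>n. v n b) {..<N} \<le> M)
        \<and> (\<forall>t\<in>{a..b}. \<forall>N. L2_set (\<lambda>n. v n t) {..<N} \<le> k)
        \<longrightarrow> (\<forall>t\<in>{a..b}. \<forall>N. L2_set (\<lambda>n. v n t) {..<N} \<le> C)"
      by blast
  qed
  then show ?thesis using chain[of p q] p by auto
qed

end

section \<open>Velocity bounds for coercive potentials\<close>

context damped_chain
begin

text \<open>A bound on the energy bounds velocities and positions, so on any interval where the energy is
  bounded \<open>energy_derivative\<close> applies. Its rate is at most \<open>C (E + 1)\<close>, where \<open>C\<close> depends on the motion
  of the driven end but not on the bound, so over times shorter than \<open>1 / (2 C)\<close> the energy at most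
  doubles up to a constant, and the bound at one end of a gap propagates through it.\<close>

lemma bounded_if_coercive:
  assumes "0 \<le> m2" and V_nonneg: "\<And>x. 0 \<le> V x"
    and coercive: "\<And>e. \<exists>R. \<forall>x. V x \<le> e \<longrightarrow> \<bar>x\<bar> \<le> R"
    and W: "\<And>R. \<exists>K\<ge>0. \<forall>x\<in>{-R..R}. \<forall>y\<in>{-R..R}. \<bar>W x - W y\<bar> \<le> K * \<bar>x - y\<bar>"
    and p: "0 < p" "p < q"
  shows "\<exists>S K X. bounded_damped_chain c \<beta> \<gamma> m2 V W u v p q S K X"
proof -
  define E where "E = total_energy c m2 V u"
  define g where "g N t = (\<Sum>n<N. energy_density c m2 V u (Suc n) t) + c\<^sup>2 / 2 * (u 1 t - u 0 t)\<^sup>2" for N t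
  have density_nonneg: "0 \<le> energy_density c m2 V u n t" for n t
    unfolding energy_density_def using \<open>0 \<le> m2\<close> V_nonneg by simp
  have g_le_E: "g N t \<le> E t" if "0 < t" for N t
    unfolding g_def E_def total_energy_def
    using sum_le_suminf[OF energy_summable[OF that], of "{..<N}"] density_nonneg by simp
  have E_le: "E t \<le> k" if "0 < t" "\<And>N. g N t \<le> k" for t k
  proof -
    have "(\<Sum>n. energy_density c m2 V u (Suc n) t) \<le> k - c\<^sup>2 / 2 * (u 1 t - u 0 t)\<^sup>2"
      using that(2) by (intro suminf_le_const energy_summable that(1)) (simp add: g_def algebra_simps)
    then show ?thesis by (simp add: E_def total_energy_def)
  qed
  have E_ge: "(\<Sum>n<N. (v (Suc n) t)\<^sup>2) / 2 + c\<^sup>2 / 2 * (u 1 t - u 0 t)\<^sup>2 \<le> E t"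
      "V (u (Suc N) t) \<le> E t" if "0 < t" for t N
  proof -
    have site: "(v n t)\<^sup>2 / 2 \<le> energy_density c m2 V u n t \<and> V (u n t) \<le> energy_density c m2 V u n t" for n
    proof -
      have "0 \<le> (v n t)\<^sup>2" "0 \<le> c\<^sup>2 * (u (Suc n) t - u n t)\<^sup>2" "0 \<le> m2 * (u n t)\<^sup>2" "0 \<le> V (u n t)"
        using \<open>0 \<le> m2\<close> V_nonneg by simp_all
      then show ?thesis unfolding energy_density_eq[OF that] by argo
    qed
    have "(\<Sum>n<N. (v (Suc n) t)\<^sup>2) / 2 \<le> (\<Sum>n<N. energy_density c m2 V u (Suc n) t)"
      unfolding sum_divide_distrib using site by (intro sum_mono) blast
    then show "(\<Sum>n<N. (v (Suc n) t)\<^sup>2) / 2 + c\<^sup>2 / 2 * (u 1 t - u 0 t)\<^sup>2 \<le> E t"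
      using g_le_E[OF that, of N] by (simp add: g_def)
    have "0 \<le> (\<Sum>n<N. energy_density c m2 V u (Suc n) t)" "0 \<le> c\<^sup>2 / 2 * (u 1 t - u 0 t)\<^sup>2"
      by (auto intro: sum_nonneg density_nonneg)
    then have "energy_density c m2 V u (Suc N) t \<le> g (Suc N) t" unfolding g_def sum.lessThan_Suc by linarith
    then show "V (u (Suc N) t) \<le> E t"
      using site[of "Suc N"] g_le_E[OF that, of "Suc N"] by linarith
  qed
  have E_nonneg: "0 \<le> E t" if "0 < t" for t
    by (rule order_trans[OF V_nonneg E_ge(2)[OF that, of 0]])
  obtain D where D: "0 \<le> D" "\<And>t. t \<in> {p..q} \<Longrightarrow> \<bar>v 0 t\<bar> \<le> D"
    using boundary_velocity_bound[OF p(1)] by blast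
  have velocity: "l2_bounded (sqrt (2 * E t)) (\<lambda>n. v (Suc n) t)" if "0 < t" for t
  proof (rule l2_boundedI)
    fix N
    have "0 \<le> c\<^sup>2 / 2 * (u 1 t - u 0 t)\<^sup>2" by simp
    then have "(\<Sum>n<N. (v (Suc n) t)\<^sup>2) \<le> 2 * E t" using E_ge(1)[OF that, of N] by linarith
    then show "(\<Sum>n<N. (v (Suc n) t)\<^sup>2) \<le> (sqrt (2 * E t))\<^sup>2"
      using E_nonneg[OF that] by simp
  qed (simp add: E_nonneg[OF that])
  have chain: "\<exists>S K X. bounded_damped_chain c \<beta> \<gamma> m2 V W u v a b S K X"
    if win: "p \<le> a" "a < b" "b \<le> q" and k: "\<And>t. t \<in> {a..b} \<Longrightarrow> E t \<le> k" for a b k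
  proof -
    obtain R where R: "\<And>x. V x \<le> k \<Longrightarrow> \<bar>x\<bar> \<le> R" using coercive by blast
    obtain K where K: "0 \<le> K" "\<forall>x\<in>{-R..R}. \<forall>y\<in>{-R..R}. \<bar>W x - W y\<bar> \<le> K * \<bar>x - y\<bar>"
      using W by blast
    have "bounded_damped_chain c \<beta> \<gamma> m2 V W u v a b (D + sqrt (2 * k)) K {-R..R}"
    proof unfold_locales
      show "0 < a" "a < b" using win p by auto
      fix t assume t: "t \<in> {a..b}"
      then have "0 < t" using win p by simp
      show "l2_bounded (D + sqrt (2 * k)) (\<lambda>n. v n t)"
      proof (rule l2_bounded_cons)
        show "\<bar>v 0 t\<bar> \<le> D" using D(2) t win by simp
        show "l2_bounded (sqrt (2 * k)) (\<lambda>n. v (Suc n) t)"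
          by (rule l2_bounded_mono[OF velocity[OF \<open>0 < t\<close>]]) (simp add: k[OF t])
      qed
      show "u (Suc n) t \<in> {-R..R}" for n
        using R[OF order_trans[OF E_ge(2)[OF \<open>0 < t\<close>, of n] k[OF t]]]
        by (simp add: abs_le_iff minus_le_iff)
    qed (use K in auto)
    then show ?thesis by blast
  qed
  define C where "C = 1 + 4 * drag + (c\<^sup>2 / 2 + drag) * D\<^sup>2"
  have "0 \<le> drag" using pos by (simp add: drag_def)
  then have "0 < C" by (simp add: C_def add_pos_nonneg)
  have energy_rate_bound: "\<bar>energy_rate t\<bar> \<le> C * (E t + 1)" if t: "t \<in> {p..q}" for t
  proof -
    have "0 < t" using t p by simp
    define P where "P = sqrt (2 * E t)"
    have P: "0 \<le> P" "P\<^sup>2 = 2 * E t" using E_nonneg[OF \<open>0 < t\<close>] by (simp_all add: P_def)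
    have vel: "l2_bounded P (\<lambda>n. v (Suc n) t)" unfolding P_def by (rule velocity[OF \<open>0 < t\<close>])
    have "l2_bounded (drag * (D + P)) (\<lambda>n. friction n t)"
      unfolding friction_def by (intro l2_bounded_friction l2_bounded_cons vel D(2) t)
    from l2_bounded_prod(2)[OF vel this]
    have "\<bar>energy_rate t - c\<^sup>2 * (u 0 t - u 1 t) * v 0 t\<bar> \<le> P * (drag * (D + P))"
      by (simp only: friction_energy_rate[OF \<open>0 < t\<close>])
    also have "\<dots> \<le> drag * (D\<^sup>2 + 2 * P\<^sup>2)"
    proof -
      have "P * (D + P) \<le> D\<^sup>2 + 2 * P\<^sup>2"
      proof -
        have "P * (D + P) = P * D + P\<^sup>2" by (simp add: power2_eq_square distrib_left)
        moreover have "2 * (P * D) \<le> P\<^sup>2 + D\<^sup>2"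
          using sum_squares_bound[of P D] by (simp only: mult.assoc)
        moreover have "0 \<le> P\<^sup>2" "0 \<le> D\<^sup>2" by simp_all
        ultimately show ?thesis by linarith
      qed
      from mult_left_mono[OF this \<open>0 \<le> drag\<close>] show ?thesis by (simp add: mult_ac)
    qed
    finally have 1: "\<bar>energy_rate t - c\<^sup>2 * (u 0 t - u 1 t) * v 0 t\<bar> \<le> drag * D\<^sup>2 + 4 * drag * E t"
      by (simp add: P algebra_simps)
    have "\<bar>(u 0 t - u 1 t) * v 0 t\<bar> \<le> \<bar>u 1 t - u 0 t\<bar> * D"
      unfolding abs_mult using D(2)[OF t] by (simp add: abs_minus_commute mult_left_mono)
    also have "\<dots> \<le> ((u 1 t - u 0 t)\<^sup>2 + D\<^sup>2) / 2"
      using sum_squares_bound[of "\<bar>u 1 t - u 0 t\<bar>" D] by simp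
    finally have "c\<^sup>2 * \<bar>(u 0 t - u 1 t) * v 0 t\<bar> \<le> c\<^sup>2 * (((u 1 t - u 0 t)\<^sup>2 + D\<^sup>2) / 2)"
      by (rule mult_left_mono) simp
    moreover have "\<bar>c\<^sup>2 * (u 0 t - u 1 t) * v 0 t\<bar> = c\<^sup>2 * \<bar>(u 0 t - u 1 t) * v 0 t\<bar>"
      by (simp add: abs_mult)
    moreover have "c\<^sup>2 * (((u 1 t - u 0 t)\<^sup>2 + D\<^sup>2) / 2) = c\<^sup>2 / 2 * (u 1 t - u 0 t)\<^sup>2 + c\<^sup>2 / 2 * D\<^sup>2"
      by (simp add: distrib_left add_divide_distrib)
    ultimately have "\<bar>c\<^sup>2 * (u 0 t - u 1 t) * v 0 t\<bar> \<le> c\<^sup>2 / 2 * (u 1 t - u 0 t)\<^sup>2 + c\<^sup>2 / 2 * D\<^sup>2"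
      by (simp only:)
    also have "\<dots> \<le> E t + c\<^sup>2 / 2 * D\<^sup>2" using E_ge(1)[OF \<open>0 < t\<close>, of 0] by simp
    finally have 2: "\<bar>c\<^sup>2 * (u 0 t - u 1 t) * v 0 t\<bar> \<le> E t + c\<^sup>2 / 2 * D\<^sup>2" .
    have "\<bar>energy_rate t\<bar> \<le> (drag * D\<^sup>2 + 4 * drag * E t) + (E t + c\<^sup>2 / 2 * D\<^sup>2)"
      using 1 2 by linarith
    also have "\<dots> = (1 + 4 * drag) * E t + (c\<^sup>2 / 2 + drag) * D\<^sup>2 * 1" by (simp add: algebra_simps)
    also have "\<dots> \<le> C * E t + C * 1"
      using E_nonneg[OF \<open>0 < t\<close>] \<open>0 \<le> drag\<close>
      by (intro add_mono mult_right_mono) (auto simp: C_def)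
    finally show ?thesis by (simp add: distrib_left)
  qed
  define h where "h = 1 / (2 * C)"
  have h: "0 < h" "C * h = 1 / 2" using \<open>0 < C\<close> by (simp_all add: h_def)
  have propagate: "E t \<le> 2 * (E s + 1 / 2)"
    if win: "p \<le> a" "a < b" "b \<le> q" "b - a < h" and k: "\<And>t. t \<in> {a..b} \<Longrightarrow> E t \<le> k"
      and s: "s \<in> {a..b}" and t: "t \<in> {a..b}" for a b k s t
  proof (rule bound_by_absorption[where g = E, OF k])
    obtain S K X where "bounded_damped_chain c \<beta> \<gamma> m2 V W u v a b S K X"
      using chain[OF win(1-3) k] by blast
    then interpret bounded_damped_chain c \<beta> \<gamma> m2 V W u v a b S K X .
    show "0 \<le> E s + 1 / 2" using E_nonneg[of s] s win p by simp
    fix M t assume M: "0 \<le> M" "\<And>t. t \<in> {a..b} \<Longrightarrow> E t \<le> M" and t: "t \<in> {a..b}"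
    have "norm (E t - E s) \<le> C * (M + 1) * norm (t - s)"
    proof (rule field_differentiable_bound[where S = "{a..b}" and f' = energy_rate])
      show "(E has_real_derivative energy_rate r) (at r within {a..b})" if "r \<in> {a..b}" for r
        unfolding E_def by (rule energy_derivative[OF that])
      show "norm (energy_rate r) \<le> C * (M + 1)" if "r \<in> {a..b}" for r
      proof -
        have "\<bar>energy_rate r\<bar> \<le> C * (E r + 1)" using that win by (intro energy_rate_bound) auto
        also have "\<dots> \<le> C * (M + 1)" using M(2)[OF that] \<open>0 < C\<close> by (intro mult_left_mono) auto
        finally show ?thesis by simp
      qed
    qed (use s t in auto)
    also have "\<dots> \<le> C * (M + 1) * h"
      using s t win M(1) \<open>0 < C\<close> by (intro mult_left_mono) auto
    also have "\<dots> = (M + 1) * (C * h)" by (simp only: mult_ac)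
    also have "\<dots> = M / 2 + 1 / 2" unfolding h by (simp add: field_simps)
    finally show "E t \<le> E s + 1 / 2 + M / 2" by (simp add: abs_le_iff)
  qed (use t in auto)
  have "\<exists>k. \<forall>t\<in>{p..q}. \<forall>N. g N t \<le> k"
  proof (rule bounded_by_propagation[OF h(1)])
    have V_cont: "continuous_on A (\<lambda>t. V (f t))" if "continuous_on A f" for f and A :: "real set"
      using DERIV_isCont[OF V_deriv]
      by (intro continuous_on_compose2[OF continuous_at_imp_continuous_on[of UNIV V] that]) auto
    show "continuous_on {p..q} (g N)" for N
    proof -
      have "continuous_on {p..q} (\<lambda>t. (\<Sum>n<N. 1 / 2 * ((v (Suc n) t)\<^sup>2
          + c\<^sup>2 * (u (Suc (Suc n)) t - u (Suc n) t)\<^sup>2 + m2 * (u (Suc n) t)\<^sup>2) + V (u (Suc n) t))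
          + c\<^sup>2 / 2 * (u 1 t - u 0 t)\<^sup>2)"
        by (intro continuous_intros V_cont v_continuous_on u_continuous_on p)
      then show ?thesis
        by (rule continuous_on_eq) (use p in \<open>simp add: g_def energy_density_eq\<close>)
    qed
    show "\<exists>k. \<forall>N. g N t \<le> k" if "t \<in> {p..q}" for t
      using g_le_E[of t] that p by auto
    have g_step: "\<forall>t\<in>{a..b}. \<forall>N. g N t \<le> 2 * (E s + 1 / 2)"
      if win: "p \<le> a" "a < b" "b \<le> q" "b - a < h" "s \<in> {a..b}" and k: "\<forall>t\<in>{a..b}. \<forall>N. g N t \<le> k"
      for a b s k
    proof (intro ballI allI)
      fix t N assume t: "t \<in> {a..b}"
      have "E r \<le> k" if "r \<in> {a..b}" for r
        using k that win p by (intro E_le) auto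
      then have "E t \<le> 2 * (E s + 1 / 2)" using propagate[OF win(1-4) _ win(5) t] by blast
      then show "g N t \<le> 2 * (E s + 1 / 2)"
        using g_le_E[of t N] t win p by simp
    qed
    show "\<exists>C. \<forall>a b k. p \<le> a \<and> a < b \<and> b \<le> q \<and> b - a < h \<and> s \<in> {a..b}
        \<and> (\<forall>t\<in>{a..b}. \<forall>N. g N t \<le> k) \<longrightarrow> (\<forall>t\<in>{a..b}. \<forall>N. g N t \<le> C)" for s
      by (rule exI[of _ "2 * (E s + 1 / 2)"]) (use g_step in blast)
    show "\<exists>C. \<forall>a b k. p \<le> a \<and> a < b \<and> b \<le> q \<and> b - a < h \<and> (\<forall>N. g N a \<le> M) \<and> (\<forall>N. g N b \<le> M)
        \<and> (\<forall>t\<in>{a..b}. \<forall>N. g N t \<le> k) \<longrightarrow> (\<forall>t\<in>{a..b}. \<forall>N. g N t \<le> C)" for M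
    proof (rule exI[of _ "2 * (M + 1 / 2)"], intro allI impI, elim conjE)
      fix a b k
      assume win: "p \<le> a" "a < b" "b \<le> q" "b - a < h" "\<forall>N. g N a \<le> M" "\<forall>t\<in>{a..b}. \<forall>N. g N t \<le> k"
      then have "E a \<le> M" using p by (intro E_le) auto
      then have le: "2 * (E a + 1 / 2) \<le> 2 * (M + 1 / 2)" by simp
      have "a \<in> {a..b}" using win(2) by simp
      note step = g_step[OF win(1-4) this win(6)]
      show "\<forall>t\<in>{a..b}. \<forall>N. g N t \<le> 2 * (M + 1 / 2)"
        by (intro ballI allI order_trans[OF step[rule_format] le])
    qed
  qed
  then obtain k where "\<forall>t\<in>{p..q}. \<forall>N. g N t \<le> k" by blast
  then show ?thesis using p by (intro chain[of p q k] E_le) auto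
qed

end

section \<open>The sine-Gordon and Klein-Gordon chains\<close>

text \<open>The densities tend to zero, and each dominates \<open>c\<^sup>2 / 2\<close> times the square of the increment.\<close>

lemma increments_not_at_top_if_nonneg:
  assumes "c > 0" "0 \<le> m2" "\<And>x. 0 \<le> V x"
    and "summable (\<lambda>n. energy_density c m2 V u (Suc n) t)"
  shows "\<not> filterlim (\<lambda>n. \<bar>u (Suc n) t - u n t\<bar>) at_top sequentially"
proof
  assume "filterlim (\<lambda>n. \<bar>u (Suc n) t - u n t\<bar>) at_top sequentially"
  then have "filterlim (\<lambda>n. \<bar>u (Suc (Suc n)) t - u (Suc n) t\<bar>) at_top sequentially"
    using filterlim_compose[OF _ filterlim_Suc] by blast
  then have "\<forall>\<^sub>F n in sequentially. 1 \<le> \<bar>u (Suc (Suc n)) t - u (Suc n) t\<bar>"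
    unfolding filterlim_at_top by blast
  moreover have "\<forall>\<^sub>F n in sequentially. energy_density c m2 V u (Suc n) t < c\<^sup>2 / 2"
    using order_tendstoD(2)[OF summable_LIMSEQ_zero[OF assms(4)], of "c\<^sup>2 / 2"] \<open>c > 0\<close> by simp
  ultimately have "\<forall>\<^sub>F n in sequentially. False"
  proof eventually_elim
    case (elim n)
    have "1\<^sup>2 \<le> \<bar>u (Suc (Suc n)) t - u (Suc n) t\<bar>\<^sup>2"
      using elim(1) by (intro power_mono) auto
    then have "c\<^sup>2 \<le> c\<^sup>2 * \<bar>u (Suc (Suc n)) t - u (Suc n) t\<bar>\<^sup>2"
      using mult_left_mono[of 1 _ "c\<^sup>2"] by fastforce
    moreover have "0 \<le> (deriv (u (Suc n)) t)\<^sup>2" "0 \<le> m2 * (u (Suc n) t)\<^sup>2" "0 \<le> V (u (Suc n) t)"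
      using assms by simp_all
    moreover have "energy_density c m2 V u (Suc n) t = 1 / 2 * ((deriv (u (Suc n)) t)\<^sup>2
        + c\<^sup>2 * \<bar>u (Suc (Suc n)) t - u (Suc n) t\<bar>\<^sup>2 + m2 * (u (Suc n) t)\<^sup>2) + V (u (Suc n) t)"
      by (simp add: energy_density_def)
    ultimately show False using elim(2) by argo
  qed
  then show False by simp
qed

lemma sine_gordon_has_derivative: "(sine_gordon_potential has_real_derivative sin x) (at x)"
  unfolding sine_gordon_potential_def[abs_def] by (auto intro!: derivative_eq_intros)

lemma sine_gordon_nonneg: "0 \<le> sine_gordon_potential x"
  by (simp add: sine_gordon_potential_def)

lemma sine_gordon_no_escape:
  assumes "c > 0" "summable (\<lambda>n. (deriv (u n) t)\<^sup>2)"
    and energy: "summable (\<lambda>n. energy_density c m2 sine_gordon_potential u (Suc n) t)"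
    and force: "(\<lambda>n. oscillator_chain.force c m2 sin u n t) \<longlonglongrightarrow> 0"
  shows "\<not> filterlim (\<lambda>n. \<bar>u (Suc n) t - u n t\<bar>) at_top sequentially"
proof (cases "0 \<le> m2")
  case True
  then show ?thesis
    using assms sine_gordon_nonneg by (intro increments_not_at_top_if_nonneg)
next
  case False
  define x where "x n = u (Suc n) t" for n
  have "(\<lambda>n. 2 * energy_density c m2 sine_gordon_potential u (Suc n) t - (deriv (u (Suc n)) t)\<^sup>2)
      \<longlonglongrightarrow> 2 * 0 - 0"
    by (intro tendsto_intros summable_LIMSEQ_zero[OF energy]
        LIMSEQ_Suc[OF summable_LIMSEQ_zero[OF assms(2)]])
  moreover have "2 * energy_density c m2 sine_gordon_potential u (Suc n) t - (deriv (u (Suc n)) t)\<^sup>2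
      = c\<^sup>2 * (x (Suc n) - x n)\<^sup>2 - (- m2) * (x n)\<^sup>2 + 2 * (1 - cos (x n))" for n
    by (simp add: energy_density_def sine_gordon_potential_def x_def algebra_simps add_divide_distrib)
  ultimately have "(\<lambda>n. c\<^sup>2 * (x (Suc n) - x n)\<^sup>2 - (- m2) * (x n)\<^sup>2 + 2 * (1 - cos (x n))) \<longlonglongrightarrow> 0"
    by (simp only: mult_zero_right diff_zero)
  moreover have "(\<lambda>n. c\<^sup>2 * (x (Suc (Suc n)) - 2 * x (Suc n) + x n) + (- m2) * x (Suc n) - sin (x (Suc n)))
      \<longlonglongrightarrow> 0"
    using LIMSEQ_Suc[OF force] by (simp add: oscillator_chain.force_def x_def laplacian_Suc)
  ultimately have "\<not> filterlim (\<lambda>n. \<bar>x (Suc n) - x n\<bar>) at_top sequentially"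
    using False \<open>c > 0\<close> by (intro sine_gordon_increments_not_at_top[of "c\<^sup>2" "- m2"]) auto
  then show ?thesis
    unfolding x_def using filterlim_compose[OF _ filterlim_Suc] by blast
qed

lemma klein_gordon_has_derivative:
  "(klein_gordon_potential has_real_derivative x - x^3 / 6 + x^5 / 120) (at x)"
  unfolding klein_gordon_potential_def[abs_def]
  by (auto intro!: derivative_eq_intros simp: fact_numeral field_simps)

text \<open>As a quadratic in \<open>x\<^sup>2\<close>, the quotient of the potential by \<open>x\<^sup>2\<close> has its minimum \<open>3 / 16\<close> at \<open>x\<^sup>2 = 15\<close>.\<close>

lemma klein_gordon_ge: "x\<^sup>2 / 8 \<le> klein_gordon_potential x"
proof -
  define y where "y = x\<^sup>2"
  have "x^4 = y\<^sup>2" "x^6 = y^3" by (simp_all add: y_def flip: power_mult)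
  then have "klein_gordon_potential x = y / 2 - y\<^sup>2 / 24 + y^3 / 720"
    by (simp add: klein_gordon_potential_def fact_numeral y_def)
  also have "\<dots> = y / 8 + y * ((y - 15)\<^sup>2 + 45) / 720"
    by (simp add: power2_eq_square power3_eq_cube field_simps)
  also have "\<dots> \<ge> y / 8" by (simp add: y_def)
  finally show ?thesis by (simp add: y_def)
qed

lemma klein_gordon_force_Lipschitz:
  "\<exists>K\<ge>0. \<forall>x\<in>{-R..R}. \<forall>y\<in>{-R..R}.
    \<bar>(x - x^3 / 6 + x^5 / 120) - (y - y^3 / 6 + y^5 / 120)\<bar> \<le> K * \<bar>x - y :: real\<bar>"
proof -
  let ?W' = "\<lambda>x::real. 1 - x\<^sup>2 / 2 + x^4 / 24"
  have "bounded (?W' ` {-R..R})"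
    by (intro compact_imp_bounded compact_continuous_image continuous_intros) auto
  then obtain K where K: "0 < K" "\<And>x. x \<in> {-R..R} \<Longrightarrow> norm (?W' x) \<le> K"
    unfolding bounded_pos by blast
  have "norm ((x - x^3 / 6 + x^5 / 120) - (y - y^3 / 6 + y^5 / 120)) \<le> K * norm (x - y)"
    if "x \<in> {-R..R}" "y \<in> {-R..R}" for x y
  proof (rule field_differentiable_bound[where S = "{-R..R}" and f' = ?W'])
    show "((\<lambda>x. x - x^3 / 6 + x^5 / 120) has_real_derivative ?W' z) (at z within {-R..R})" for z
      by (auto intro!: derivative_eq_intros simp: field_simps)
  qed (use K that in auto)
  then show ?thesis using K(1) by (intro exI[of _ K]) auto
qed

lemma damped_chain_if_solution:
  assumes "c > 0" "\<beta> \<ge> 0" "\<gamma> \<ge> 0"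
    and \<psi>: "\<psi> C1_differentiable_on {0<..}"
    and sol: "mixed_value_solution c \<beta> \<gamma> m2 V \<phi> \<phi>v \<psi> u"
    and v: "\<And>t. t > 0 \<Longrightarrow> square_summable (\<lambda>n. deriv (u n) t)"
    and energy: "\<And>t. t > 0 \<Longrightarrow> summable (\<lambda>n. energy_density c m2 V u (Suc n) t)"
    and V: "\<And>x. (V has_real_derivative W x) (at x)"
    and no_escape: "\<And>t. t > 0 \<Longrightarrow> (\<lambda>n. oscillator_chain.force c m2 W u n t) \<longlonglongrightarrow> 0 \<Longrightarrow>
      \<not> filterlim (\<lambda>n. \<bar>u (Suc n) t - u n t\<bar>) at_top sequentially"
  shows "damped_chain c \<beta> \<gamma> m2 V W u (\<lambda>n. deriv (u n))"
proof -
  obtain \<psi>' where \<psi>': "\<And>t. 0 < t \<Longrightarrow> (\<psi> has_real_derivative \<psi>' t) (at t)" "continuous_on {0<..} \<psi>'"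
    using \<psi> unfolding C1_differentiable_on_def has_real_derivative_iff_has_vector_derivative by auto
  have u0: "(u 0 has_real_derivative \<psi>' t) (at t)" if "0 < t" for t
  proof (rule has_field_derivative_transform_within_open[OF \<psi>'(1)[OF that], of "{0<..}"])
    show "\<psi> s = u 0 s" if "s \<in> {0<..}" for s
      using sol that unfolding mixed_value_solution_def by simp
  qed (use that in auto)
  have u': "(u n has_real_derivative deriv (u n) t) (at t)" if "0 < t" for n t
  proof (cases n)
    case 0
    then show ?thesis using u0[OF that] DERIV_imp_deriv[OF u0[OF that]] by simp
  next
    case (Suc k)
    then have "u n differentiable (at t)"
      using sol that unfolding mixed_value_solution_def by simp
    then show ?thesis by (simp add: DERIV_deriv_iff_real_differentiable)
  qed
  have v': "(deriv (u (Suc n)) has_real_derivative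
      oscillator_chain.force c m2 W u n t + oscillator_chain.friction \<beta> \<gamma> (\<lambda>n. deriv (u n)) n t) (at t)" if "0 < t" for n t
  proof -
    have "((\<lambda>s. laplacian (\<lambda>k. u k s) (Suc n)) has_real_derivative
        laplacian (\<lambda>k. deriv (u k) t) (Suc n)) (at t)"
      unfolding laplacian_Suc using u'[OF that] by (auto intro!: derivative_eq_intros)
    then have lap: "deriv (\<lambda>s. laplacian (\<lambda>k. u k s) (Suc n)) t = laplacian (\<lambda>k. deriv (u k) t) (Suc n)"
      by (rule DERIV_imp_deriv)
    have "deriv (u (Suc n)) differentiable (at t) \<and> deriv (deriv (u (Suc n))) t
         - (c\<^sup>2 * laplacian (\<lambda>k. u k t) (Suc n) + \<beta> * deriv (\<lambda>s. laplacian (\<lambda>k. u k s) (Suc n)) t)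
         + \<gamma> * deriv (u (Suc n)) t + m2 * u (Suc n) t + deriv V (u (Suc n) t) = 0"
      using sol that unfolding mixed_value_solution_def by simp
    then have "(deriv (u (Suc n)) has_real_derivative deriv (deriv (u (Suc n))) t) (at t)"
      "deriv (deriv (u (Suc n))) t = oscillator_chain.force c m2 W u n t + oscillator_chain.friction \<beta> \<gamma> (\<lambda>n. deriv (u n)) n t"
      by (simp_all add: DERIV_deriv_iff_real_differentiable oscillator_chain.force_def oscillator_chain.friction_def
          lap DERIV_imp_deriv[OF V])
    then show ?thesis by simp
  qed
  have "continuous_on {0<..} (deriv (u 0))"
    by (rule continuous_on_eq[OF \<psi>'(2)]) (simp add: DERIV_imp_deriv[OF u0])
  then show ?thesis
    using assms(1-3) u' v' V v energy no_escape
    by unfold_locales (auto simp: square_summable_def)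
qed

theorem proposition2:
  fixes c \<beta> \<gamma> m2 :: real
    and V \<psi> :: "real \<Rightarrow> real"
    and \<phi> \<phi>v :: "nat \<Rightarrow> real"
    and u :: "nat \<Rightarrow> real \<Rightarrow> real"
  assumes "c > 0" and "\<beta> \<ge> 0" and "\<gamma> \<ge> 0"
    and "V = sine_gordon_potential \<or> (V = klein_gordon_potential \<and> m2 = 0)"
    and "\<psi> C1_differentiable_on {0<..}"
    and "mixed_value_solution c \<beta> \<gamma> m2 V \<phi> \<phi>v \<psi> u"
    and "\<And>t. t > 0 \<Longrightarrow> square_summable (\<lambda>n. deriv (u n) t)"
    and "\<And>t. t > 0 \<Longrightarrow> summable (\<lambda>n. energy_density c m2 V u (Suc n) t)"
    and "t > 0"
  shows "(total_energy c m2 V u has_real_derivative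
      c^2 * (u 0 t - u 1 t) * deriv (u 0) t
      - \<gamma> * (\<Sum>n. (deriv (u (Suc n)) t)^2)
      - \<beta> * ((\<Sum>n. (deriv (u (Suc n)) t - deriv (u n) t)^2)
          + (deriv (u 1) t - deriv (u 0) t) * deriv (u 0) t)) (at t)"
proof -
  let ?v = "\<lambda>n. deriv (u n)"
  \<comment> \<open>any compact interval around \<open>t\<close> that avoids time \<open>0\<close>\<close>
  have window: "0 < t / 2" "t / 2 < 2 * t" "t \<in> {t / 2..2 * t}" using \<open>t > 0\<close> by auto
  obtain W S K X where "bounded_damped_chain c \<beta> \<gamma> m2 V W u ?v (t / 2) (2 * t) S K X"
    using assms(4)
  proof (elim disjE conjE)
    assume V: "V = sine_gordon_potential"
    have "\<not> filterlim (\<lambda>n. \<bar>u (Suc n) t - u n t\<bar>) at_top sequentially"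
      if "0 < t" "(\<lambda>n. oscillator_chain.force c m2 sin u n t) \<longlonglongrightarrow> 0" for t
      using assms(1,7,8) that unfolding V square_summable_def by (intro sine_gordon_no_escape)
    then interpret damped_chain c \<beta> \<gamma> m2 V sin u ?v
      using sine_gordon_has_derivative V
      by (intro damped_chain_if_solution[OF assms(1-3,5-8)]) auto
    have "\<bar>sin x - sin y\<bar> \<le> 1 * \<bar>x - y\<bar>" for x y :: real
      using field_differentiable_bound[of UNIV sin cos 1 x y] by (simp add: DERIV_sin)
    with bounded_if_Lipschitz[OF zero_le_one this window(1,2)] that show thesis by blast
  next
    assume V: "V = klein_gordon_potential" "m2 = 0"
    have nonneg: "0 \<le> V x" for x
      using klein_gordon_ge[of x] zero_le_power2[of x] unfolding V by linarith
    have "\<not> filterlim (\<lambda>n. \<bar>u (Suc n) t - u n t\<bar>) at_top sequentially" if "0 < t" for t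
      using V(2) nonneg by (intro increments_not_at_top_if_nonneg[OF assms(1) _ _ assms(8)[OF that]]) auto
    then interpret damped_chain c \<beta> \<gamma> m2 V "\<lambda>x. x - x^3 / 6 + x^5 / 120" u ?v
      using klein_gordon_has_derivative V(1)
      by (intro damped_chain_if_solution[OF assms(1-3,5-8)]) auto
    have "\<exists>R. \<forall>x. V x \<le> e \<longrightarrow> \<bar>x\<bar> \<le> R" for e
    proof (intro exI[of _ "sqrt (8 * e)"] allI impI)
      fix x assume "V x \<le> e"
      then have "x\<^sup>2 \<le> 8 * e" using klein_gordon_ge[of x] unfolding V by linarith
      then show "\<bar>x\<bar> \<le> sqrt (8 * e)" by (simp add: real_le_rsqrt)
    qed
    with bounded_if_coercive[OF _ nonneg _ klein_gordon_force_Lipschitz window(1,2)] V(2) that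
    show thesis by blast
  qed
  then interpret bounded_damped_chain c \<beta> \<gamma> m2 V W u ?v "t / 2" "2 * t" S K X .
  have "at t within {t / 2..2 * t} = at t"
    using \<open>t > 0\<close> by (intro at_within_Icc_at) auto
  then show ?thesis
    using energy_derivative[OF window(3)] by (simp add: energy_rate_def)
qed

end
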